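(* Let $M$ be a closed oriented Riemannian three-manifold with a finite triangulation $K$, and let $C^1(K)=V_{\mathrm p}\oplus V_{\mathrm g}$ be the orthogonal splitting with $V_{\mathrm p}=\mathcal H^1_K\oplus\operatorname{im}\delta_1^\ast$ and $V_{\mathrm g}=\operatorname{im}\delta_0$. Let $\mu=\mathcal N(m_\mu,\Sigma_\mu)$ and $\nu=\mathcal N(m_\nu,\Sigma_\nu)$ be nondegenerate Gaussian probability measures on $V_{\mathrm p}\oplus V_{\mathrm g}$ with $$m_\mu=\begin{pmatrix}m_{\mu,\mathrm p}\\ m_{\mu,\mathrm g}\end{pmatrix},\quad m_\nu=\begin{pmatrix}m_{\nu,\mathrm p}\\ m_{\nu,\mathrm g}\end{pmatrix},\quad \Sigma_\mu=\begin{pmatrix}A_\mu&B_\mu\\ B_\mu^\top&C_\mu\end{pmatrix},\quad \Sigma_\nu=\begin{pmatrix}A_\nu&B_\nu\\ B_\nu^\top&C_\nu\end{pmatrix}$$ in blocks relative to $V_{\mathrm p}\oplus V_{\mathrm g}$, and put $R_\mu=B_\mu^\top A_\mu^{-1}$, $R_\nu=B_\nu^\top A_\nu^{-1}$, $S_\mu=C_\mu-B_\mu^\top A_\mu^{-1}B_\mu$, $S_\nu=C_\nu-B_\nu^\top A_\nu^{-1}B_\nu$. Let $\mu_{\mathrm p}=(P_{\mathrm p})_\#\mu$ and $\nu_{\mathrm p}=(P_{\mathrm p})_\#\nu$ be the physical marginals. Then $$D(\mu\|\nu)=D(\mu_{\mathrm p}\|\nu_{\mathrm p})$$ if and only if $S_\mu=S_\nu$,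 $R_\mu=R_\nu$, and $$m_{\mu,\mathrm g}-m_{\nu,\mathrm g}=R_\nu\left(m_{\mu,\mathrm p}-m_{\nu,\mathrm p}\right).$$
   Context: $C^k(K)=C^k(K;\mathbb R)$ is the space of real simplicial $k$-cochains of $K$, $\delta_k:C^k(K)\to C^{k+1}(K)$ is the coboundary, and $W_k:C^k(K)\to\Omega^k_{\mathrm{pw}}(M)$ are the Whitney maps into piecewise smooth forms (the linear maps sending the cochain dual to an oriented simplex $[v_0,\dots,v_k]$ to $k!\sum_{i}(-1)^i\lambda_i\,d\lambda_0\wedge\cdots\wedge\widehat{d\lambda_i}\wedge\cdots\wedge d\lambda_k$, with $\lambda_i$ the barycentric coordinate function of $v_i$). Each $C^k(K)$ carries the Whitney inner product $\langle u,v\rangle_k=\int_M W_k(u)\wedge\star W_k(v)$, and $\delta_k^\ast$ denotes the adjoint of $\delta_k$ for these inner products. The harmonic space is $\mathcal H^1_K=\ker\delta_1\cap\ker\delta_0^\ast$, and one has the orthogonal discrete Hodge decomposition $C^1(K)=\operatorname{im}\delta_0\oplus\mathcal H^1_K\oplus\operatorname{im}\delta_1^\ast$. $P_{\mathrm p}:C^1(K)\to V_{\mathrm p}$ is the orthogonal projection onto $V_{\mathrm p}$ (with kernel $V_{\mathrm g}$), and $(P_{\mathrm p})_\#$ denotes pushforward of measures. Elements of $C^1(K)$ are written in Whitney-orthonormal coordinates as $a=(x,y)$ with $x\in V_{\mathrm p}$, $y\in V_{\mathrm g}$, and means and covariance matrices are taken in these coordinates. Nondegenerate means that the covariance matrix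 is positive definite. For probability measures with (Lebesgue) densities $f,g$ the relative entropy is $D(f\|g)=\int f\log(f/g)$. *)

theory Defs
  imports "HOL-Probability.Probability" "HOL-Combinatorics.Permutations"
begin

section \<open>Closed oriented Riemannian three-manifolds\<close>

text \<open>For open \<open>S\<close> in a finite-dimensional space this is the class of \<open>k\<close> times continuously
  differentiable functions: the Frechet derivative exists and all directional derivatives are
  \<open>k - 1\<close> times continuously differentiable.\<close>

primrec Ck_on :: "nat \<Rightarrow> 'a::real_normed_vector set \<Rightarrow> ('a \<Rightarrow> 'b::real_normed_vector) \<Rightarrow> bool" where
  "Ck_on 0 S f \<longleftrightarrow> continuous_on S f"
| "Ck_on (Suc k) S f \<longleftrightarrow>
     (\<exists>f'. (\<forall>x\<in>S. (f has_derivative f' x) (at x)) \<and> (\<forall>v. Ck_on k S (\<lambda>x. f' x v)))"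

definition smooth_on :: "'a::real_normed_vector set \<Rightarrow> ('a \<Rightarrow> 'b::real_normed_vector) \<Rightarrow> bool" where
  "smooth_on S f \<longleftrightarrow> (\<forall>k. Ck_on k S f)"

definition jacobian :: "(real^3 \<Rightarrow> real^3) \<Rightarrow> real^3 \<Rightarrow> real^3^3" where
  "jacobian F x = matrix (frechet_derivative F (at x))"

definition pos_def_matrix :: "real^'n^'n \<Rightarrow> bool" where
  "pos_def_matrix S \<longleftrightarrow> transpose S = S \<and> (\<forall>x. x \<noteq> 0 \<longrightarrow> x \<bullet> (S *v x) > 0)"

type_synonym 'm chart = "'m set \<times> ('m \<Rightarrow> real^3)"

definition transition :: "'m chart \<Rightarrow> 'm chart \<Rightarrow> real^3 \<Rightarrow> real^3" where
  "transition c d = snd d \<circ> inv_into (fst c) (snd c)"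

text \<open>A Riemannian metric is given by its Gram matrices \<open>g c\<close> in the charts \<open>c\<close> of the atlas, which
  transform as a covariant 2-tensor. The atlas is oriented. Second countability follows from
  compactness, and connectedness is not required.\<close>

definition closed_oriented_riemannian_3manifold ::
  "'m::t2_space set \<Rightarrow> 'm chart set \<Rightarrow> ('m chart \<Rightarrow> real^3 \<Rightarrow> real^3^3) \<Rightarrow> bool" where
  "closed_oriented_riemannian_3manifold M \<A> g \<longleftrightarrow>
     compact M \<and> M = (\<Union>c\<in>\<A>. fst c) \<and>
     (\<forall>c\<in>\<A>. openin (top_of_set M) (fst c) \<and> open (snd c ` fst c) \<and>
        homeomorphism (fst c) (snd c ` fst c) (snd c) (inv_into (fst c) (snd c)) \<and>
        smooth_on (snd c ` fst c) (g c) \<and> (\<forall>x\<in>snd c ` fst c. pos_def_matrix (g c x))) \<and>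
     (\<forall>c\<in>\<A>. \<forall>d\<in>\<A>. smooth_on (snd c ` (fst c \<inter> fst d)) (transition c d) \<and>
        (\<forall>x\<in>snd c ` (fst c \<inter> fst d).
           det (jacobian (transition c d) x) > 0 \<and>
           g c x = transpose (jacobian (transition c d) x) ** g d (transition c d x) **
                   jacobian (transition c d) x))"


section \<open>Smooth triangulations\<close>

definition simplicial_complex :: "'v set set \<Rightarrow> bool" where
  "simplicial_complex K \<longleftrightarrow> (\<forall>s\<in>K. s \<noteq> {} \<and> (\<forall>t. t \<subseteq> s \<and> t \<noteq> {} \<longrightarrow> t \<in> K))"

definition simplices :: "'v set set \<Rightarrow> nat \<Rightarrow> 'v set set" where
  "simplices K k = {s\<in>K. card s = Suc k}"

text \<open>The geometric realization lives in the space spanned by the vertices, so that the coordinate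
  \<open>x $ v\<close> of one of its points is the barycentric coordinate belonging to \<open>v\<close>.\<close>

definition realization :: "'v::finite set set \<Rightarrow> (real^'v) set" where
  "realization K = (\<Union>s\<in>K. convex hull ((\<lambda>v. axis v 1) ` s))"

definition std_tetrahedron :: "(real^3) set" where
  "std_tetrahedron = {x. 0 \<le> x $ 1 \<and> 0 \<le> x $ 2 \<and> 0 \<le> x $ 3 \<and> x $ 1 + x $ 2 + x $ 3 \<le> 1}"

text \<open>Affine parametrization of a tetrahedron \<open>\<sigma>\<close> of the realization, with vertices in increasing
  order.\<close>

definition tet_param :: "'v::{finite,linorder} set \<Rightarrow> real^3 \<Rightarrow> real^'v::{finite,linorder}" where
  "tet_param \<sigma> x =
     (1 - x $ 1 - x $ 2 - x $ 3) *\<^sub>R axis (sorted_list_of_set \<sigma> ! 0) 1 +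
     (x $ 1) *\<^sub>R axis (sorted_list_of_set \<sigma> ! 1) 1 +
     (x $ 2) *\<^sub>R axis (sorted_list_of_set \<sigma> ! 2) 1 +
     (x $ 3) *\<^sub>R axis (sorted_list_of_set \<sigma> ! 3) 1"

text \<open>A triangulation is a homeomorphism \<open>h\<close> from the realization of a finite complex that restricts
  to a smooth immersion of each closed tetrahedron, smoothness at boundary points being the
  existence of local smooth extensions. No purity of \<open>K\<close> is imposed: by invariance
  of domain every simplex lies in a tetrahedron, which also covers smoothness on the lower-dimensional
  simplices.\<close>

definition smooth_triangulation ::
  "'m::t2_space set \<Rightarrow> 'm chart set \<Rightarrow> 'v::{finite,linorder} set set \<Rightarrow> (real^'v::{finite,linorder} \<Rightarrow> 'm) \<Rightarrow> bool" where
  "smooth_triangulation M \<A> K h \<longleftrightarrow>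
     simplicial_complex K \<and>
     homeomorphism (realization K) M h (inv_into (realization K) h) \<and>
     (\<forall>\<sigma>\<in>simplices K 3. \<forall>x\<in>std_tetrahedron.
        \<exists>c\<in>\<A>. \<exists>N F. open N \<and> x \<in> N \<and> smooth_on N F \<and> det (jacobian F x) \<noteq> 0 \<and>
          (\<forall>y\<in>N \<inter> std_tetrahedron.
             h (tet_param \<sigma> y) \<in> fst c \<and> F y = snd c (h (tet_param \<sigma> y))))"


section \<open>Simplicial cochains\<close>

text \<open>Each simplex is oriented by the order of its vertices; a \<open>k\<close>-cochain is given by its values on
  the \<open>k\<close>-simplices so oriented.\<close>

definition cochains :: "'v::{finite,linorder} set set \<Rightarrow> nat \<Rightarrow> (real^('v set)) set" where
  "cochains K k = {c. \<forall>s. s \<notin> simplices K k \<longrightarrow> c $ s = 0}"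

definition coboundary ::
  "'v::{finite,linorder} set set \<Rightarrow> nat \<Rightarrow> real^('v set) \<Rightarrow> real^('v set)" where
  "coboundary K k c =
     (\<chi> s. if s \<in> simplices K (Suc k)
            then \<Sum>i\<le>Suc k. (-1) ^ i * c $ (s - {sorted_list_of_set s ! i}) else 0)"


section \<open>Exterior algebra of three-space\<close>

text \<open>A \<open>k\<close>-covector is an alternating function of the first \<open>k\<close> entries of a sequence of vectors.\<close>

type_synonym covector = "(nat \<Rightarrow> real^3) \<Rightarrow> real"

definition wedge :: "nat \<Rightarrow> nat \<Rightarrow> covector \<Rightarrow> covector \<Rightarrow> covector" where
  "wedge k l \<alpha> \<beta> X =
     (\<Sum>\<pi> | \<pi> permutes {..<k + l}. of_int (sign \<pi>) * \<alpha> (\<lambda>i. X (\<pi> i)) * \<beta> (\<lambda>i. X (\<pi> (k + i))))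
     / (fact k * fact l)"

primrec wedge_list :: "(real^3 \<Rightarrow> real) list \<Rightarrow> covector" where
  "wedge_list [] = (\<lambda>X. 1)"
| "wedge_list (a # as) = wedge 1 (length as) (\<lambda>X. a (X 0)) (wedge_list as)"

text \<open>\<open>\<rho>\<close> is the coefficient of the oriented volume form, so \<open>\<rho>\<^sup>2 = det G\<close> for the Gram matrix \<open>G\<close>.\<close>

definition volume_form :: "real \<Rightarrow> covector" where
  "volume_form \<rho> X = \<rho> * det (vector [X 0, X 1, X 2] :: real^3^3)"

text \<open>The coordinate formula for the star: raise the indices of \<open>\<beta>\<close> and contract with the volume
  form. It is characterized by
  \<open>\<alpha> \<and> \<star>\<beta> = \<langle>\<alpha>,\<beta>\<rangle> vol\<close>.\<close>

definition hodge_star :: "nat \<Rightarrow> real^3^3 \<Rightarrow> real \<Rightarrow> covector \<Rightarrow> covector" where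
  "hodge_star k G \<rho> \<beta> Y =
     (\<Sum>a\<in>{..<k} \<rightarrow>\<^sub>E UNIV. \<Sum>b\<in>{..<k} \<rightarrow>\<^sub>E UNIV.
        (\<Prod>i<k. matrix_inv G $ a i $ b i) * \<beta> (\<lambda>i. axis (a i) 1) *
        volume_form \<rho> (\<lambda>i. if i < k then axis (b i) 1 else Y (i - k)))
     / fact k"


section \<open>Whitney forms and the Whitney inner product\<close>

text \<open>Piecewise smooth forms are represented on each tetrahedron by their pullbacks under
  \<open>h \<circ> tet_param \<sigma>\<close>.\<close>

definition bary :: "'v::{finite,linorder} set \<Rightarrow> 'v \<Rightarrow> real^3 \<Rightarrow> real" where
  "bary \<sigma> v x = tet_param \<sigma> x $ v"

definition whitney_simplex_form ::
  "'v::{finite,linorder} list \<Rightarrow> 'v set \<Rightarrow> real^3 \<Rightarrow> covector" where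
  "whitney_simplex_form vs \<sigma> x X =
     fact (length vs - 1) *
     (\<Sum>i<length vs. (-1) ^ i * bary \<sigma> (vs ! i) x *
        wedge_list (map (\<lambda>v. frechet_derivative (bary \<sigma> v) (at x)) (take i vs @ drop (Suc i) vs)) X)"

definition whitney_map ::
  "'v::{finite,linorder} set set \<Rightarrow> nat \<Rightarrow> real^('v set) \<Rightarrow> 'v set \<Rightarrow> real^3 \<Rightarrow> covector" where
  "whitney_map K k c \<sigma> x X =
     (\<Sum>s\<in>simplices K k. c $ s * whitney_simplex_form (sorted_list_of_set s) \<sigma> x X)"

definition chart_at :: "'m chart set \<Rightarrow> 'm \<Rightarrow> 'm chart" where
  "chart_at \<A> q = (SOME c. c \<in> \<A> \<and> q \<in> fst c)"

text \<open>The Gram matrix and the volume coefficient of the pulled back metric, and the Jacobian of the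
  parametrization, at interior points of the standard tetrahedron. The Gram matrix and the volume
  coefficient do not depend on the chart used.\<close>

definition tet_jacobian ::
  "'m chart set \<Rightarrow> (real^'v::{finite,linorder} \<Rightarrow> 'm) \<Rightarrow> 'v::{finite,linorder} set \<Rightarrow> real^3 \<Rightarrow> real^3^3" where
  "tet_jacobian \<A> h \<sigma> x = jacobian (snd (chart_at \<A> (h (tet_param \<sigma> x))) \<circ> h \<circ> tet_param \<sigma>) x"

definition tet_chart_metric ::
  "'m chart set \<Rightarrow> ('m chart \<Rightarrow> real^3 \<Rightarrow> real^3^3) \<Rightarrow> (real^'v::{finite,linorder} \<Rightarrow> 'm) \<Rightarrow>
   'v::{finite,linorder} set \<Rightarrow> real^3 \<Rightarrow> real^3^3" where
  "tet_chart_metric \<A> g h \<sigma> x =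
     (let q = h (tet_param \<sigma> x); c = chart_at \<A> q in g c (snd c q))"

definition tet_metric ::
  "'m chart set \<Rightarrow> ('m chart \<Rightarrow> real^3 \<Rightarrow> real^3^3) \<Rightarrow> (real^'v::{finite,linorder} \<Rightarrow> 'm) \<Rightarrow>
   'v::{finite,linorder} set \<Rightarrow> real^3 \<Rightarrow> real^3^3" where
  "tet_metric \<A> g h \<sigma> x =
     transpose (tet_jacobian \<A> h \<sigma> x) ** tet_chart_metric \<A> g h \<sigma> x ** tet_jacobian \<A> h \<sigma> x"

definition tet_volume ::
  "'m chart set \<Rightarrow> ('m chart \<Rightarrow> real^3 \<Rightarrow> real^3^3) \<Rightarrow> (real^'v::{finite,linorder} \<Rightarrow> 'm) \<Rightarrow>
   'v::{finite,linorder} set \<Rightarrow> real^3 \<Rightarrow> real" where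
  "tet_volume \<A> g h \<sigma> x = sqrt (det (tet_chart_metric \<A> g h \<sigma> x)) * det (tet_jacobian \<A> h \<sigma> x)"

text \<open>The integral over \<open>M\<close> of a piecewise smooth 3-form. The sign accounts for parametrizations that
  reverse the orientation.\<close>

definition integral_3form ::
  "'m chart set \<Rightarrow> 'v::{finite,linorder} set set \<Rightarrow> (real^'v::{finite,linorder} \<Rightarrow> 'm) \<Rightarrow>
   ('v set \<Rightarrow> real^3 \<Rightarrow> covector) \<Rightarrow> real" where
  "integral_3form \<A> K h \<omega> =
     (\<Sum>\<sigma>\<in>simplices K 3. LINT x:interior std_tetrahedron|lborel.
        sgn (det (tet_jacobian \<A> h \<sigma> x)) *
        \<omega> \<sigma> x (\<lambda>i. if i = 0 then axis 1 1 else if i = 1 then axis 2 1 else axis 3 1))"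

definition whitney_inner ::
  "'m chart set \<Rightarrow> ('m chart \<Rightarrow> real^3 \<Rightarrow> real^3^3) \<Rightarrow> 'v::{finite,linorder} set set \<Rightarrow>
   (real^'v::{finite,linorder} \<Rightarrow> 'm) \<Rightarrow> nat \<Rightarrow> real^('v set) \<Rightarrow> real^('v set) \<Rightarrow> real" where
  "whitney_inner \<A> g K h k u v =
     integral_3form \<A> K h (\<lambda>\<sigma> x. wedge k (3 - k) (whitney_map K k u \<sigma> x)
       (hodge_star k (tet_metric \<A> g h \<sigma> x) (tet_volume \<A> g h \<sigma> x) (whitney_map K k v \<sigma> x)))"


section \<open>Physical and gauge cochains\<close>

text \<open>The graph of the adjoint \<open>\<delta>\<^sub>k\<^sup>*\<close> of the coboundary for the Whitney inner products: this relation
  says \<open>\<delta>\<^sub>k\<^sup>* w = u\<close>.\<close>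

definition is_codiff ::
  "'m chart set \<Rightarrow> ('m chart \<Rightarrow> real^3 \<Rightarrow> real^3^3) \<Rightarrow> 'v::{finite,linorder} set set \<Rightarrow>
   (real^'v::{finite,linorder} \<Rightarrow> 'm) \<Rightarrow> nat \<Rightarrow> real^('v set) \<Rightarrow> real^('v set) \<Rightarrow> bool" where
  "is_codiff \<A> g K h k w u \<longleftrightarrow>
     w \<in> cochains K (Suc k) \<and> u \<in> cochains K k \<and>
     (\<forall>c\<in>cochains K k.
        whitney_inner \<A> g K h (Suc k) (coboundary K k c) w = whitney_inner \<A> g K h k c u)"

definition harmonic_space ::
  "'m chart set \<Rightarrow> ('m chart \<Rightarrow> real^3 \<Rightarrow> real^3^3) \<Rightarrow> 'v::{finite,linorder} set set \<Rightarrow>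
   (real^'v::{finite,linorder} \<Rightarrow> 'm) \<Rightarrow> (real^('v set)) set" where
  "harmonic_space \<A> g K h = {a\<in>cochains K 1. coboundary K 1 a = 0 \<and> is_codiff \<A> g K h 0 a 0}"

definition physical_space ::
  "'m chart set \<Rightarrow> ('m chart \<Rightarrow> real^3 \<Rightarrow> real^3^3) \<Rightarrow> 'v::{finite,linorder} set set \<Rightarrow>
   (real^'v::{finite,linorder} \<Rightarrow> 'm) \<Rightarrow> (real^('v set)) set" where
  "physical_space \<A> g K h =
     {a + b | a b. a \<in> harmonic_space \<A> g K h \<and> (\<exists>w. is_codiff \<A> g K h 1 w b)}"

definition gauge_space :: "'v::{finite,linorder} set set \<Rightarrow> (real^('v set)) set" where
  "gauge_space K = coboundary K 0 ` cochains K 0"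

definition physical_projection ::
  "'m chart set \<Rightarrow> ('m chart \<Rightarrow> real^3 \<Rightarrow> real^3^3) \<Rightarrow> 'v::{finite,linorder} set set \<Rightarrow>
   (real^'v::{finite,linorder} \<Rightarrow> 'm) \<Rightarrow> real^('v set) \<Rightarrow> real^('v set)" where
  "physical_projection \<A> g K h a =
     (THE x. x \<in> physical_space \<A> g K h \<and>
        (\<forall>y\<in>physical_space \<A> g K h. whitney_inner \<A> g K h 1 (a - x) y = 0))"

definition whitney_orthonormal_basis ::
  "'m chart set \<Rightarrow> ('m chart \<Rightarrow> real^3 \<Rightarrow> real^3^3) \<Rightarrow> 'v::{finite,linorder} set set \<Rightarrow>
   (real^'v::{finite,linorder} \<Rightarrow> 'm) \<Rightarrow> ('i \<Rightarrow> real^('v set)) \<Rightarrow> (real^('v set)) set \<Rightarrow> bool" where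
  "whitney_orthonormal_basis \<A> g K h e V \<longleftrightarrow>
     span (range e) = V \<and>
     (\<forall>i j. whitney_inner \<A> g K h 1 (e i) (e j) = (if i = j then 1 else 0))"


section \<open>Gaussian measures\<close>

definition block_vector :: "real^'p \<Rightarrow> real^'q \<Rightarrow> real^('p + 'q)" where
  "block_vector x y = (\<chi> i. case_sum (\<lambda>j. x $ j) (\<lambda>j. y $ j) i)"

text \<open>The symmetric block matrix with rows \<open>(A, B)\<close> and \<open>(B\<^sup>T, C)\<close>.\<close>

definition block_matrix :: "real^'p^'p \<Rightarrow> real^'q^'p \<Rightarrow> real^'q^'q \<Rightarrow> real^('p + 'q)^('p + 'q)" where
  "block_matrix A B C =
     (\<chi> i. case_sum (\<lambda>j. block_vector (A $ j) (B $ j)) (\<lambda>j. block_vector (transpose B $ j) (C $ j)) i)"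

definition gaussian :: "real^'n \<Rightarrow> real^'n^'n \<Rightarrow> (real^'n) measure" where
  "gaussian m \<Sigma> = density lborel (\<lambda>x. ennreal
     (exp (- ((x - m) \<bullet> (matrix_inv \<Sigma> *v (x - m))) / 2) / sqrt ((2 * pi) ^ CARD('n) * det \<Sigma>)))"

text \<open>The Gaussian measure on \<open>C\<^sup>1(K)\<close> whose mean and covariance in the coordinates given by the bases
  \<open>e\<close>, \<open>f\<close> are \<open>m\<close> and \<open>\<Sigma>\<close>.\<close>

definition cochain_gaussian ::
  "'v::{finite,linorder} set set \<Rightarrow> ('p::finite \<Rightarrow> real^('v set)) \<Rightarrow> ('q::finite \<Rightarrow> real^('v set)) \<Rightarrow>
   real^('p + 'q) \<Rightarrow> real^('p + 'q)^('p + 'q) \<Rightarrow> (real^('v set)) measure" where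
  "cochain_gaussian K e f m \<Sigma> =
     distr (gaussian m \<Sigma>) (restrict_space borel (cochains K 1))
       (\<lambda>z. \<Sum>i\<in>UNIV. z $ i *\<^sub>R case_sum e f i)"

definition physical_marginal ::
  "'m chart set \<Rightarrow> ('m chart \<Rightarrow> real^3 \<Rightarrow> real^3^3) \<Rightarrow> 'v::{finite,linorder} set set \<Rightarrow>
   (real^'v::{finite,linorder} \<Rightarrow> 'm) \<Rightarrow> (real^('v set)) measure \<Rightarrow> (real^('v set)) measure" where
  "physical_marginal \<A> g K h \<mu> =
     distr \<mu> (restrict_space borel (physical_space \<A> g K h)) (physical_projection \<A> g K h)"

text \<open>The library's divergence takes the reference measure first.\<close>

definition relative_entropy :: "'a measure \<Rightarrow> 'a measure \<Rightarrow> real" where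
  "relative_entropy \<mu> \<nu> = KL_divergence (exp 1) \<nu> \<mu>"

end

(*
Conditioning on the physical coordinates x factors a Gaussian density as a(x) k(x, y), where a is the
density of the physical marginal N(m_p, A) and k(x, .) that of N(m_g + R (x - m_p), S). Hence
D(mu || nu) - D(mu_p || nu_p) is the integral of a k_mu ln (k_mu / k_nu), which vanishes iff the
conditional densities agree almost everywhere, by continuity everywhere, that is, iff S, R and the
conditional means agree.

Passing from cochains to coordinates only needs that the Whitney product is bilinear and that gauge
cochains are orthogonal to physical ones: the projection is then a |-> sum_i <a, e_i> e_i, and the
coordinate map has a linear left inverse, under which relative entropy is invariant. Bilinearity
rests on the pulled back metric being independent of the chart and continuous up to the boundary of
each tetrahedron.
*)
theory Submission
  imports Defs
begin

section \<open>Smooth maps and matrices\<close>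

text \<open>Cochains form a subspace of their ambient space, so the Gaussians on them need not have
  a Lebesgue density there; both divergences are therefore pulled back to coordinates, where all
  densities are positive. Two obstacles shape the rest. First, the logarithm of the joint ratio may
  be split into a marginal and a conditional part under the integral only once each part is known to
  be integrable. This holds because the logarithm of a Gaussian density grows at most quadratically
  and Gaussian densities have finite second moments. Second, \<open>chart_at\<close> picks a chart
  at each point with no regularity whatsoever, so the Whitney integrand is controlled by comparing
  it, near each point of the closed tetrahedron, with its expression in one fixed chart. The
  integral of the conditional log ratio has no pointwise sign; adding a function of integral 0 turns
  its integrand into a nonnegative one, and this is what lets a vanishing integral force equality
  almost everywhere.\<close>

lemma smooth_on_imp_continuous_on: "smooth_on S f \<Longrightarrow> continuous_on S f"
  unfolding smooth_on_def by (metis Ck_on.simps(1))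

lemma Ck_on_subset: "Ck_on k S f \<Longrightarrow> T \<subseteq> S \<Longrightarrow> Ck_on k T f"
proof (induction k arbitrary: f)
  case 0 then show ?case by (auto intro: continuous_on_subset)
next
  case (Suc k)
  from Suc.prems(1) obtain f' where "\<forall>x\<in>S. (f has_derivative f' x) (at x)" "\<forall>v. Ck_on k S (\<lambda>x. f' x v)"
    by auto
  then show ?case using Suc.IH Suc.prems(2) by (auto intro!: exI[of _ f'])
qed

lemma smooth_on_subset: "smooth_on S f \<Longrightarrow> T \<subseteq> S \<Longrightarrow> smooth_on T f"
  unfolding smooth_on_def by (blast intro: Ck_on_subset)

lemma smooth_on_has_derivative_jacobian:
  assumes "smooth_on S F" "x \<in> S"
  shows "(F has_derivative (\<lambda>v. jacobian F x *v v)) (at x)"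
proof -
  have "Ck_on (Suc 0) S F" using assms by (auto simp: smooth_on_def)
  then obtain F' where d: "(F has_derivative F' x) (at x)" using assms(2) by auto
  then have "F differentiable at x" by (auto simp: differentiable_def)
  then have "(F has_derivative frechet_derivative F (at x)) (at x)"
    by (simp add: frechet_derivative_works)
  moreover from this have "linear (frechet_derivative F (at x))" by (rule has_derivative_linear)
  then have "frechet_derivative F (at x) = (\<lambda>v. jacobian F x *v v)"
    by (auto simp: jacobian_def matrix_works fun_eq_iff)
  ultimately show ?thesis by simp
qed

lemma jacobian_eqI:
  assumes "(F has_derivative (\<lambda>v. A *v v)) (at x)"
  shows "jacobian F x = A"
  using frechet_derivative_at[OF assms, symmetric] by (simp add: jacobian_def)

text \<open>The entries of the Jacobian are components of directional derivatives along axis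
  vectors, and these are continuous by the case \<open>k = 1\<close> of
  \<open>Ck_on\<close>.\<close>

lemma continuous_on_jacobian:
  assumes "smooth_on S F"
  shows "continuous_on S (jacobian F)"
proof -
  have "Ck_on (Suc 0) S F" using assms by (auto simp: smooth_on_def)
  then obtain F' where d: "\<And>x. x \<in> S \<Longrightarrow> (F has_derivative F' x) (at x)"
    and c: "\<And>v. continuous_on S (\<lambda>x. F' x v)" by auto
  have "jacobian F x = (\<chi> i j. F' x (axis j 1) $ i)" if "x \<in> S" for x
    using frechet_derivative_at[OF d[OF that]] by (simp add: jacobian_def matrix_def)
  moreover have "continuous_on S (\<lambda>x. \<chi> i j. F' x (axis j 1) $ i)"
    by (intro continuous_intros c)
  ultimately show ?thesis by (simp cong: continuous_on_cong)
qed

section \<open>Continuity of determinants, products and inverses of matrices\<close>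

lemma continuous_on_det [continuous_intros]:
  fixes G :: "'a::topological_space \<Rightarrow> real^'n^'n"
  assumes "continuous_on S G"
  shows "continuous_on S (\<lambda>x. det (G x))"
  unfolding det_def by (intro continuous_intros assms)

lemma continuous_on_matrix_mult [continuous_intros]:
  fixes F :: "'a::topological_space \<Rightarrow> real^'n^'m" and G :: "'a \<Rightarrow> real^'k^'n"
  assumes "continuous_on S F" "continuous_on S G"
  shows "continuous_on S (\<lambda>x. F x ** G x)"
  unfolding matrix_matrix_mult_def by (intro continuous_intros assms)

lemma continuous_on_transpose [continuous_intros]:
  fixes F :: "'a::topological_space \<Rightarrow> real^'n^'m"
  assumes "continuous_on S F"
  shows "continuous_on S (\<lambda>x. transpose (F x))"
  unfolding transpose_def by (intro continuous_intros assms)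

lemma
  fixes A :: "'a::semiring_1^'n^'m"
  assumes "invertible A"
  shows matrix_inv_right: "A ** matrix_inv A = mat 1"
    and matrix_inv_left: "matrix_inv A ** A = mat 1"
  using someI_ex[of "\<lambda>A'. A ** A' = mat 1 \<and> A' ** A = mat 1"] assms
  unfolding matrix_inv_def invertible_def by auto

text \<open>Column \<open>l\<close> of the inverse solves \<open>A *v z = axis l 1\<close>, so
  Cramer's rule gives its entries as quotients of determinants. This is how continuity passes to
  \<open>matrix_inv\<close>.\<close>

lemma matrix_inv_cramer:
  fixes A :: "real^'n^'n"
  assumes "det A \<noteq> 0"
  shows "matrix_inv A $ k $ l =
    det (\<chi> i j. if j = k then axis l 1 $ i else A $ i $ j) / det A"
proof -
  have "A *v (matrix_inv A *v axis l 1) = axis l 1"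
    using assms by (simp add: matrix_vector_mul_assoc matrix_inv_right invertible_det_nz)
  then have "matrix_inv A *v axis l 1 =
      (\<chi> k. det (\<chi> i j. if j = k then axis l 1 $ i else A $ i $ j) / det A)"
    using cramer[OF assms] by blast
  then show ?thesis by (simp add: matrix_vector_mul_component inner_axis vec_eq_iff)
qed

lemma continuous_on_matrix_inv:
  fixes G :: "'a::topological_space \<Rightarrow> real^'n^'n"
  assumes "continuous_on S G" "\<And>x. x \<in> S \<Longrightarrow> det (G x) \<noteq> 0"
  shows "continuous_on S (\<lambda>x. matrix_inv (G x) $ k $ l)"
proof -
  have "continuous_on S (\<lambda>x. \<chi> i j. if j = k then axis l 1 $ i else G x $ i $ j)"
  proof (intro continuous_on_vec_lambda)
    show "continuous_on S (\<lambda>x. if j = k then axis l 1 $ i else G x $ i $ j)" for i j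
      by (cases "j = k") (auto intro!: continuous_intros assms)
  qed
  then have "continuous_on S
      (\<lambda>x. det (\<chi> i j. if j = k then axis l 1 $ i else G x $ i $ j) / det (G x))"
    using assms(2) by (intro continuous_on_divide continuous_on_det assms(1)) auto
  then show ?thesis using assms(2) by (simp add: matrix_inv_cramer cong: continuous_on_cong)
qed

lemma pos_def_matrix_invertible: "pos_def_matrix S \<Longrightarrow> invertible S"
  unfolding pos_def_matrix_def
  by (metis inner_zero_right matrix_left_invertible_ker invertible_left_inverse less_irrefl)

lemma det_transpose_mult_mult:
  fixes T :: "real^'n^'n"
  shows "det (transpose T ** G ** T) = det G * (det T)\<^sup>2"
  by (simp add: det_mul power2_eq_square mult.commute)

section \<open>The Whitney inner product is bilinear\<close>

text \<open>Functions on \<open>U\<close> that extend continuously across each point of \<open>S\<close>. On a compact \<open>S\<close> they are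
  bounded; bilinearity needs the integrability this gives, since the Bochner integral of a
  non-integrable function is \<open>0\<close>.\<close>

definition locally_extendable :: "'a::topological_space set \<Rightarrow> 'a set \<Rightarrow> ('a \<Rightarrow> 'b::topological_space) \<Rightarrow> bool" where
  "locally_extendable S U \<phi> \<longleftrightarrow>
     (\<forall>x\<in>S. \<exists>N \<psi>. open N \<and> x \<in> N \<and> continuous_on N \<psi> \<and> (\<forall>y\<in>N \<inter> U. \<phi> y = \<psi> y))"

lemma locally_extendable_continuous:
  "continuous_on UNIV \<phi> \<Longrightarrow> locally_extendable S U \<phi>"
  unfolding locally_extendable_def by (metis UNIV_I open_UNIV)

lemma locally_extendable_binop:
  fixes \<phi> \<psi> :: "'a::topological_space \<Rightarrow> real"
  assumes "locally_extendable S U \<phi>" "locally_extendable S U \<psi>"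
    and op: "\<And>N (f :: 'a \<Rightarrow> real) g. continuous_on N f \<Longrightarrow> continuous_on N g \<Longrightarrow>
        continuous_on N (\<lambda>x. op (f x) (g x))"
  shows "locally_extendable S U (\<lambda>x. op (\<phi> x) (\<psi> x))"
  unfolding locally_extendable_def
proof
  fix x assume "x \<in> S"
  then obtain N f N' f' where
    "open N" "x \<in> N" "continuous_on N f" "\<forall>y\<in>N \<inter> U. \<phi> y = f y"
    "open N'" "x \<in> N'" "continuous_on N' f'" "\<forall>y\<in>N' \<inter> U. \<psi> y = f' y"
    using assms(1,2) unfolding locally_extendable_def by meson
  then show "\<exists>N f. open N \<and> x \<in> N \<and> continuous_on N f \<and> (\<forall>y\<in>N \<inter> U. op (\<phi> y) (\<psi> y) = f y)"
    by (intro exI[of _ "N \<inter> N'"] exI[of _ "\<lambda>y. op (f y) (f' y)"])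
      (auto intro!: op intro: continuous_on_subset)
qed

lemma locally_extendable_add:
  fixes \<phi> \<psi> :: "'a::topological_space \<Rightarrow> real"
  shows "locally_extendable S U \<phi> \<Longrightarrow> locally_extendable S U \<psi> \<Longrightarrow>
    locally_extendable S U (\<lambda>x. \<phi> x + \<psi> x)"
  by (rule locally_extendable_binop) (auto intro: continuous_intros)

lemma locally_extendable_mult:
  fixes \<phi> \<psi> :: "'a::topological_space \<Rightarrow> real"
  shows "locally_extendable S U \<phi> \<Longrightarrow> locally_extendable S U \<psi> \<Longrightarrow>
    locally_extendable S U (\<lambda>x. \<phi> x * \<psi> x)"
  by (rule locally_extendable_binop) (auto intro: continuous_intros)

lemma locally_extendable_const: "locally_extendable S U (\<lambda>x. c)"
  by (intro locally_extendable_continuous continuous_intros)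

lemma locally_extendable_sum:
  fixes \<phi> :: "'i \<Rightarrow> 'a::topological_space \<Rightarrow> real"
  shows "(\<And>i. i \<in> I \<Longrightarrow> locally_extendable S U (\<phi> i)) \<Longrightarrow> locally_extendable S U (\<lambda>x. \<Sum>i\<in>I. \<phi> i x)"
  by (induction I rule: infinite_finite_induct)
    (auto intro: locally_extendable_add locally_extendable_const)

lemma locally_extendable_prod:
  fixes \<phi> :: "'i \<Rightarrow> 'a::topological_space \<Rightarrow> real"
  shows "(\<And>i. i \<in> I \<Longrightarrow> locally_extendable S U (\<phi> i)) \<Longrightarrow> locally_extendable S U (\<lambda>x. \<Prod>i\<in>I. \<phi> i x)"
  by (induction I rule: infinite_finite_induct)
    (auto intro: locally_extendable_mult locally_extendable_const)

lemma locally_extendable_divide: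
  fixes \<phi> :: "'a::topological_space \<Rightarrow> real"
  shows "locally_extendable S U \<phi> \<Longrightarrow> locally_extendable S U (\<lambda>x. \<phi> x / c)"
  using locally_extendable_mult[OF _ locally_extendable_const, of S U \<phi> "inverse c"]
  by (simp add: divide_inverse)

lemmas locally_extendable_intros = locally_extendable_add locally_extendable_mult
  locally_extendable_const locally_extendable_sum locally_extendable_prod locally_extendable_divide

text \<open>The local extensions bound the function near each point of \<open>S\<close>; finitely
  many such neighbourhoods cover the compact \<open>S\<close>. Boundedness on the open set
  \<open>U\<close>, continuity there and finite measure of \<open>U\<close> give
  integrability.\<close>

lemma locally_extendable_set_integrable:
  fixes \<phi> :: "'a::euclidean_space \<Rightarrow> real"
  assumes "locally_extendable S U \<phi>" "compact S" "open U" "U \<subseteq> S"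
  shows "set_integrable lborel U \<phi>"
proof -
  let ?C = "{N. open N \<and> (\<exists>B. \<forall>y\<in>N \<inter> U. \<bar>\<phi> y\<bar> \<le> B)}"
  have "\<exists>N\<in>?C. x \<in> N" if x: "x \<in> S" for x
  proof -
    obtain N \<psi> where N: "open N" "x \<in> N" "continuous_on N \<psi>" "\<forall>y\<in>N \<inter> U. \<phi> y = \<psi> y"
      using bspec[OF assms(1)[unfolded locally_extendable_def] x] by blast
    \<comment> \<open>The extension may be unbounded on \<open>N\<close>; where it stays within 1 of
      its value at \<open>x\<close> the bound is \<open>\<bar>\<psi> x\<bar> + 1\<close>.\<close>
    have o: "open (\<psi> -` ball (\<psi> x) 1 \<inter> N)"
      using N continuous_on_open_vimage by blast
    show ?thesis
    proof (intro bexI[of _ "\<psi> -` ball (\<psi> x) 1 \<inter> N"])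
      have "\<bar>\<phi> y\<bar> \<le> \<bar>\<psi> x\<bar> + 1" if "y \<in> (\<psi> -` ball (\<psi> x) 1 \<inter> N) \<inter> U" for y
        using that N(4) by (auto simp: dist_real_def)
      then show "\<psi> -` ball (\<psi> x) 1 \<inter> N \<in> ?C" using o by blast
    qed (use N in auto)
  qed
  then have "S \<subseteq> \<Union>?C" by blast
  then obtain D where D: "D \<subseteq> ?C" "finite D" "S \<subseteq> \<Union>D"
    using compactE[OF assms(2)] by (metis (no_types, lifting) mem_Collect_eq)
  from D(1) have "\<forall>N\<in>D. \<exists>B. \<forall>y\<in>N \<inter> U. \<bar>\<phi> y\<bar> \<le> B" by auto
  then obtain b where b: "\<And>N y. N \<in> D \<Longrightarrow> y \<in> N \<inter> U \<Longrightarrow> \<bar>\<phi> y\<bar> \<le> b N"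
    by metis
  \<comment> \<open>The sum of absolute values dominates each local bound and, unlike a maximum,
    makes sense for an empty cover.\<close>
  define B where "B = (\<Sum>N\<in>D. \<bar>b N\<bar>)"
  have B: "\<bar>\<phi> y\<bar> \<le> B" if y: "y \<in> U" for y
  proof -
    obtain N where "N \<in> D" "y \<in> N" using y D(3) assms(4) by blast
    then have "\<bar>\<phi> y\<bar> \<le> \<bar>b N\<bar>" using b[of N y] y by auto
    also have "\<dots> \<le> B" unfolding B_def using \<open>N \<in> D\<close> D(2) by (intro member_le_sum) auto
    finally show ?thesis .
  qed
  have "continuous_on U \<phi>"
    unfolding continuous_on_eq_continuous_at[OF assms(3)]
  proof
    fix x assume x: "x \<in> U"
    then obtain N \<psi> where N: "open N" "x \<in> N" "continuous_on N \<psi>" "\<forall>y\<in>N \<inter> U. \<phi> y = \<psi> y"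
      using bspec[OF assms(1)[unfolded locally_extendable_def] subsetD[OF assms(4) x]] by blast
    have "continuous_on (N \<inter> U) \<phi>"
      using continuous_on_subset[OF N(3), of "N \<inter> U"] N(4) continuous_on_cong[OF refl, of "N \<inter> U" \<phi> \<psi>] by simp
    then show "isCont \<phi> x"
      using N x assms(3) by (simp add: continuous_on_eq_continuous_at open_Int)
  qed
  then have m: "(\<lambda>x. indicator U x *\<^sub>R \<phi> x) \<in> borel_measurable lborel"
    using borel_measurable_continuous_on_indicator[of U \<phi>] assms(3) by simp
  have fin: "emeasure lborel U < \<infinity>"
    using assms(2,4) by (meson bounded_subset compact_imp_bounded emeasure_bounded_finite)
  show ?thesis
    unfolding set_integrable_def
  proof (rule Bochner_Integration.integrable_bound)
    show "integrable lborel (\<lambda>x. indicator U x * B)"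
      using fin assms(3) by (intro integrable_mult_left integrable_real_indicator) auto
    show "AE x in lborel. norm (indicator U x *\<^sub>R \<phi> x) \<le> norm (indicator U x * B)"
      by (rule AE_I2) (auto simp: indicator_def intro: order_trans[OF B])
  qed (rule m)
qed

section \<open>The pulled back metric in different charts and up to the boundary\<close>

lemma smooth_triangulation_chart:
  assumes "smooth_triangulation M \<A> K h" "\<sigma> \<in> simplices K 3" "x \<in> std_tetrahedron"
  obtains c N F where "c \<in> \<A>" "open N" "x \<in> N" "smooth_on N F" "det (jacobian F x) \<noteq> 0"
    "\<And>y. y \<in> N \<inter> std_tetrahedron \<Longrightarrow> h (tet_param \<sigma> y) \<in> fst c \<and> F y = snd c (h (tet_param \<sigma> y))"
proof -
  have "\<exists>c\<in>\<A>. \<exists>N F. open N \<and> x \<in> N \<and> smooth_on N F \<and> det (jacobian F x) \<noteq> 0 \<and>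
      (\<forall>y\<in>N \<inter> std_tetrahedron. h (tet_param \<sigma> y) \<in> fst c \<and> F y = snd c (h (tet_param \<sigma> y)))"
    using assms unfolding smooth_triangulation_def by blast
  then show thesis using that by blast
qed

lemma transition_chart:
  assumes "inj_on (snd c) (fst c)" "q \<in> fst c"
  shows "transition c d (snd c q) = snd d q"
  using assms by (simp add: transition_def)

lemma
  assumes man: "closed_oriented_riemannian_3manifold M \<A> g" and c: "c \<in> \<A>"
  shows chart_inj_on: "inj_on (snd c) (fst c)"
    and chart_open_image: "open (snd c ` fst c)"
    and chart_metric_continuous: "continuous_on (snd c ` fst c) (g c)"
    and chart_metric_pos_def: "x \<in> snd c ` fst c \<Longrightarrow> pos_def_matrix (g c x)"
proof -
  have *: "homeomorphism (fst c) (snd c ` fst c) (snd c) (inv_into (fst c) (snd c))"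
    "open (snd c ` fst c)" "smooth_on (snd c ` fst c) (g c)"
    "\<forall>x\<in>snd c ` fst c. pos_def_matrix (g c x)"
    using man c unfolding closed_oriented_riemannian_3manifold_def by auto
  show "inj_on (snd c) (fst c)" by (rule inj_on_inverseI) (rule homeomorphism_apply1[OF *(1)])
  show "open (snd c ` fst c)" "continuous_on (snd c ` fst c) (g c)"
    "x \<in> snd c ` fst c \<Longrightarrow> pos_def_matrix (g c x)"
    using *(2-4) smooth_on_imp_continuous_on by blast+
qed

text \<open>The overlap is open in \<open>M\<close>, hence in the domain of \<open>c\<close>, and
  the homeomorphism \<open>snd c\<close> carries it to a relatively open part of an open set.
  Openness is what makes the preimage of the overlap a neighbourhood in the chain rule argument
  below.\<close>

lemma chart_open_inter_image:
  assumes man: "closed_oriented_riemannian_3manifold M \<A> g" and c: "c \<in> \<A>" and d: "d \<in> \<A>"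
  shows "open (snd c ` (fst c \<inter> fst d))"
proof -
  have *: "homeomorphism (fst c) (snd c ` fst c) (snd c) (inv_into (fst c) (snd c))"
    "open (snd c ` fst c)" "openin (top_of_set M) (fst d)" "openin (top_of_set M) (fst c)"
    using man c d unfolding closed_oriented_riemannian_3manifold_def by auto
  have "openin (top_of_set (fst c)) (fst c \<inter> fst d)"
    by (rule openin_subset_trans[OF openin_Int[OF *(4,3)]])
      (use openin_imp_subset[OF *(4)] in auto)
  then have "openin (top_of_set (snd c ` fst c)) (snd c ` (fst c \<inter> fst d))"
    using homeomorphism_imp_open_map[OF *(1)] by blast
  then show ?thesis using *(2) openin_open_eq by blast
qed

lemma chart_at_cover:
  assumes "closed_oriented_riemannian_3manifold M \<A> g" "c \<in> \<A>" "q \<in> fst c"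
  shows "chart_at \<A> q \<in> \<A>" "q \<in> fst (chart_at \<A> q)"
proof -
  have "\<exists>c. c \<in> \<A> \<and> q \<in> fst c" using assms(2,3) by blast
  from someI_ex[OF this] show "chart_at \<A> q \<in> \<A>" "q \<in> fst (chart_at \<A> q)"
    by (auto simp: chart_at_def)
qed

text \<open>Passing from \<open>c\<close> to the chart chosen by \<open>chart_at\<close> multiplies
  the Jacobian by that of the transition map, and the transformation law of the metric cancels this
  factor. In the volume coefficient the sign makes the determinant an absolute value, and the factor
  moves into the square root.\<close>

lemma
  assumes man: "closed_oriented_riemannian_3manifold M \<A> g" and c: "c \<in> \<A>"
    and N: "open N" "smooth_on N F" "N \<subseteq> std_tetrahedron"
    and F: "\<And>y. y \<in> N \<Longrightarrow> h (tet_param \<sigma> y) \<in> fst c \<and> F y = snd c (h (tet_param \<sigma> y))"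
    and y: "y \<in> N"
  shows tet_metric_chart: "tet_metric \<A> g h \<sigma> y =
      transpose (jacobian F y) ** g c (F y) ** jacobian F y" (is ?A)
    and tet_volume_chart: "sgn (det (tet_jacobian \<A> h \<sigma> y)) * tet_volume \<A> g h \<sigma> y =
      sqrt (det (g c (F y))) * \<bar>det (jacobian F y)\<bar>" (is ?B)
proof -
  define q where "q = h (tet_param \<sigma> y)"
  define d where "d = chart_at \<A> q"
  have qc: "q \<in> fst c" and Fy: "F y = snd c q" using F[OF y] by (auto simp: q_def)
  have d: "d \<in> \<A>" and qd: "q \<in> fst d"
    using chart_at_cover[OF man c qc] by (auto simp: d_def)
  let ?O = "snd c ` (fst c \<inter> fst d)"
  let ?T = "jacobian (transition c d) (F y)"
  have FyO: "F y \<in> ?O" using Fy qc qd by auto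
  have trans: "smooth_on ?O (transition c d)"
    "g c (F y) = transpose ?T ** g d (transition c d (F y)) ** ?T"
    using man c d FyO unfolding closed_oriented_riemannian_3manifold_def by blast+
  have inj: "inj_on (snd c) (fst c)" by (rule chart_inj_on[OF man c])
  have tq: "transition c d (F y) = snd d q"
    unfolding Fy by (rule transition_chart[OF inj qc])
  \<comment> \<open>A derivative at \<open>y\<close> sees only values near \<open>y\<close>: on this
    open set \<open>F\<close> lands in the overlap, so the two coordinate expressions differ by the
    transition map throughout.\<close>
  let ?N' = "F -` ?O \<inter> N"
  have N': "open ?N'"
    using continuous_on_open_vimage[OF N(1)] smooth_on_imp_continuous_on[OF N(2)]
      chart_open_inter_image[OF man c d] by blast
  have eq: "transition c d (F z) = (snd d \<circ> h \<circ> tet_param \<sigma>) z" if "z \<in> ?N'" for z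
    using transition_chart[OF inj, of "h (tet_param \<sigma> z)" d] F[of z] that by auto
  have "((\<lambda>z. transition c d (F z)) has_derivative (\<lambda>v. ?T *v (jacobian F y *v v))) (at y)"
    by (rule has_derivative_compose[OF smooth_on_has_derivative_jacobian[OF N(2) y]
          smooth_on_has_derivative_jacobian[OF trans(1) FyO]])
  then have "((snd d \<circ> h \<circ> tet_param \<sigma>) has_derivative (\<lambda>v. ?T *v (jacobian F y *v v))) (at y)"
    by (rule has_derivative_transform_within_open[OF _ N' _ eq]) (use FyO y in auto)
  then have J: "tet_jacobian \<A> h \<sigma> y = ?T ** jacobian F y"
    unfolding tet_jacobian_def q_def[symmetric] d_def[symmetric]
    by (intro jacobian_eqI) (simp add: matrix_vector_mul_assoc)
  have G: "tet_chart_metric \<A> g h \<sigma> y = g d (transition c d (F y))"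
    by (simp add: tet_chart_metric_def Let_def tq flip: q_def d_def)
  show ?A
    by (simp add: tet_metric_def J G trans(2) matrix_transpose_mul matrix_mul_assoc)
  have "sgn (det (tet_jacobian \<A> h \<sigma> y)) * tet_volume \<A> g h \<sigma> y =
      sqrt (det (g d (transition c d (F y)))) * \<bar>det (tet_jacobian \<A> h \<sigma> y)\<bar>"
    by (simp add: tet_volume_def G abs_sgn)
  also have "\<dots> = sqrt (det (g c (F y))) * \<bar>det (jacobian F y)\<bar>"
    by (simp add: J det_mul trans(2) real_sqrt_mult abs_mult power2_eq_square)
  finally show ?B .
qed

text \<open>At a boundary point the pulled back quantities are available only on one side. The local
  extension \<open>F\<close> provided by the triangulation is defined on both sides, so the formulas
  in its chart are continuous on a full neighbourhood and agree with those quantities in the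
  interior.\<close>

lemma tet_metric_extension:
  assumes man: "closed_oriented_riemannian_3manifold M \<A> g"
    and tri: "smooth_triangulation M \<A> K h" and \<sigma>: "\<sigma> \<in> simplices K 3"
    and x: "x \<in> std_tetrahedron"
  obtains P \<psi> \<rho> where "open P" "x \<in> P" "continuous_on P \<psi>" "continuous_on P \<rho>"
    "\<forall>y\<in>P \<inter> interior std_tetrahedron. matrix_inv (tet_metric \<A> g h \<sigma> y) $ a $ b = \<psi> y"
    "\<forall>y\<in>P \<inter> interior std_tetrahedron.
       sgn (det (tet_jacobian \<A> h \<sigma> y)) * tet_volume \<A> g h \<sigma> y = \<rho> y"
proof -
  obtain c N F where c: "c \<in> \<A>" and N: "open N" "x \<in> N" "smooth_on N F"
    and J: "det (jacobian F x) \<noteq> 0"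
    and F: "\<And>y. y \<in> N \<inter> std_tetrahedron \<Longrightarrow>
      h (tet_param \<sigma> y) \<in> fst c \<and> F y = snd c (h (tet_param \<sigma> y))"
    using smooth_triangulation_chart[OF tri \<sigma> x] by metis
  have cF: "continuous_on N F" and cJ: "continuous_on N (jacobian F)"
    using N by (auto intro: smooth_on_imp_continuous_on continuous_on_jacobian)
  \<comment> \<open>The first set keeps \<open>F\<close> in the domain of \<open>g c\<close>, the
    second keeps the Jacobian of \<open>F\<close> invertible, so that the metric has an inverse on
    all of \<open>P\<close>.\<close>
  define P where "P = (F -` (snd c ` fst c) \<inter> N) \<inter> ((\<lambda>y. det (jacobian F y)) -` (-{0}) \<inter> N)"
  have "open (F -` (snd c ` fst c) \<inter> N)"
    using continuous_on_open_vimage[OF N(1), of F] cF chart_open_image[OF man c] by blast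
  moreover have "open ((\<lambda>y. det (jacobian F y)) -` (-{0}) \<inter> N)"
    using continuous_on_open_vimage[OF N(1)] continuous_on_det[OF cJ] by blast
  moreover have "F x \<in> snd c ` fst c" using F[of x] N(2) x by blast
  ultimately have P: "open P" "x \<in> P" "P \<subseteq> N"
    unfolding P_def using N(2) J by (blast intro: open_Int, simp, blast)
  let ?G = "\<lambda>y. transpose (jacobian F y) ** g c (F y) ** jacobian F y"
  have cg: "continuous_on P (\<lambda>y. g c (F y))"
    by (rule continuous_on_compose2[OF chart_metric_continuous[OF man c]])
      (use cF P(3) in \<open>auto simp: P_def intro: continuous_on_subset\<close>)
  have cJP: "continuous_on P (jacobian F)"
    using cJ P(3) continuous_on_subset by blast
  have "det (?G y) \<noteq> 0" if "y \<in> P" for y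
  proof -
    have "F y \<in> snd c ` fst c" "det (jacobian F y) \<noteq> 0" using that by (auto simp: P_def)
    then show ?thesis
      using pos_def_matrix_invertible[OF chart_metric_pos_def[OF man c]]
      by (auto simp: det_transpose_mult_mult invertible_det_nz)
  qed
  then have c1: "continuous_on P (\<lambda>y. matrix_inv (?G y) $ a $ b)"
    by (intro continuous_on_matrix_inv continuous_intros cg cJP) auto
  have c2: "continuous_on P (\<lambda>y. sqrt (det (g c (F y))) * \<bar>det (jacobian F y)\<bar>)"
    by (intro continuous_intros cg cJP)
  have loc: "tet_metric \<A> g h \<sigma> y = ?G y"
    "sgn (det (tet_jacobian \<A> h \<sigma> y)) * tet_volume \<A> g h \<sigma> y =
     sqrt (det (g c (F y))) * \<bar>det (jacobian F y)\<bar>"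
    if "y \<in> P \<inter> interior std_tetrahedron" for y
  proof -
    \<comment> \<open>The comparison of charts differentiates
      \<open>h \<circ> tet_param \<sigma>\<close>, hence the restriction to an open subset of the
      tetrahedron.\<close>
    let ?Q = "P \<inter> interior std_tetrahedron"
    have Q: "open ?Q" "?Q \<subseteq> std_tetrahedron" "?Q \<subseteq> N"
      using P interior_subset by auto
    have s: "smooth_on ?Q F"
      using N(3) Q(3) by (rule smooth_on_subset)
    have F': "h (tet_param \<sigma> y) \<in> fst c \<and> F y = snd c (h (tet_param \<sigma> y))" if "y \<in> ?Q" for y
      using F[of y] Q that by auto
    show "tet_metric \<A> g h \<sigma> y = ?G y"
      by (rule tet_metric_chart[OF man c Q(1) s Q(2) F' that])
    show "sgn (det (tet_jacobian \<A> h \<sigma> y)) * tet_volume \<A> g h \<sigma> y =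
     sqrt (det (g c (F y))) * \<bar>det (jacobian F y)\<bar>"
      by (rule tet_volume_chart[OF man c Q(1) s Q(2) F' that])
  qed
  show thesis
    by (rule that[OF P(1,2) c1 c2]) (use loc in auto)
qed

lemma
  assumes man: "closed_oriented_riemannian_3manifold M \<A> g"
    and tri: "smooth_triangulation M \<A> K h" and \<sigma>: "\<sigma> \<in> simplices K 3"
  shows locally_extendable_tet_metric_inv: "locally_extendable std_tetrahedron (interior std_tetrahedron)
      (\<lambda>x. matrix_inv (tet_metric \<A> g h \<sigma> x) $ a $ b)" (is ?A)
    and locally_extendable_tet_volume: "locally_extendable std_tetrahedron (interior std_tetrahedron)
      (\<lambda>x. sgn (det (tet_jacobian \<A> h \<sigma> x)) * tet_volume \<A> g h \<sigma> x)" (is ?B)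
proof -
  show ?A
    unfolding locally_extendable_def
  proof
    fix x :: "real^3" assume "x \<in> std_tetrahedron"
    then obtain P \<psi> \<rho> where "open P" "x \<in> P" "continuous_on P \<psi>" "continuous_on P \<rho>"
      "\<forall>y\<in>P \<inter> interior std_tetrahedron. matrix_inv (tet_metric \<A> g h \<sigma> y) $ a $ b = \<psi> y"
      "\<forall>y\<in>P \<inter> interior std_tetrahedron.
         sgn (det (tet_jacobian \<A> h \<sigma> y)) * tet_volume \<A> g h \<sigma> y = \<rho> y"
      by (rule tet_metric_extension[OF man tri \<sigma>])
    then show "\<exists>N \<psi>. open N \<and> x \<in> N \<and> continuous_on N \<psi> \<and>
        (\<forall>y\<in>N \<inter> interior std_tetrahedron. matrix_inv (tet_metric \<A> g h \<sigma> y) $ a $ b = \<psi> y)"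
      by (intro exI[of _ P] exI[of _ \<psi>]) simp
  qed
  show ?B
    unfolding locally_extendable_def
  proof
    fix x :: "real^3" assume "x \<in> std_tetrahedron"
    then obtain P \<psi> \<rho> where "open P" "x \<in> P" "continuous_on P \<psi>" "continuous_on P \<rho>"
      "\<forall>y\<in>P \<inter> interior std_tetrahedron. matrix_inv (tet_metric \<A> g h \<sigma> y) $ a $ b = \<psi> y"
      "\<forall>y\<in>P \<inter> interior std_tetrahedron.
         sgn (det (tet_jacobian \<A> h \<sigma> y)) * tet_volume \<A> g h \<sigma> y = \<rho> y"
      by (rule tet_metric_extension[OF man tri \<sigma>])
    then show "\<exists>N \<rho>. open N \<and> x \<in> N \<and> continuous_on N \<rho> \<and>
        (\<forall>y\<in>N \<inter> interior std_tetrahedron.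
          sgn (det (tet_jacobian \<A> h \<sigma> y)) * tet_volume \<A> g h \<sigma> y = \<rho> y)"
      by (intro exI[of _ P] exI[of _ \<rho>]) simp
  qed
qed

section \<open>Linearity of wedge, star and Whitney maps; regularity of the integrand\<close>

lemma wedge_add_left: "wedge k l (\<lambda>X. \<alpha> X + \<alpha>' X) \<beta> X = wedge k l \<alpha> \<beta> X + wedge k l \<alpha>' \<beta> X"
  by (simp add: wedge_def distrib_left distrib_right sum.distrib add_divide_distrib)

lemma wedge_add_right: "wedge k l \<alpha> (\<lambda>X. \<beta> X + \<beta>' X) X = wedge k l \<alpha> \<beta> X + wedge k l \<alpha> \<beta>' X"
  by (simp add: wedge_def distrib_left distrib_right sum.distrib add_divide_distrib)

lemma wedge_scale_left: "wedge k l (\<lambda>X. r * \<alpha> X) \<beta> X = r * wedge k l \<alpha> \<beta> X"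
  by (simp add: wedge_def sum_distrib_left mult_ac)

lemma wedge_scale_right: "wedge k l \<alpha> (\<lambda>X. r * \<beta> X) X = r * wedge k l \<alpha> \<beta> X"
  by (simp add: wedge_def sum_distrib_left mult_ac)

lemma hodge_star_add: "hodge_star k G \<rho> (\<lambda>X. \<beta> X + \<beta>' X) = (\<lambda>Y. hodge_star k G \<rho> \<beta> Y + hodge_star k G \<rho> \<beta>' Y)"
  by (simp add: hodge_star_def fun_eq_iff distrib_left distrib_right sum.distrib add_divide_distrib)

lemma hodge_star_scale: "hodge_star k G \<rho> (\<lambda>X. r * \<beta> X) = (\<lambda>Y. r * hodge_star k G \<rho> \<beta> Y)"
  by (simp add: hodge_star_def fun_eq_iff sum_distrib_left mult_ac)

text \<open>Lets the orientation sign be absorbed into the volume coefficient;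
  \<open>locally_extendable_tet_volume\<close> controls the product of the two.\<close>

lemma hodge_star_volume_scale: "hodge_star k G (r * \<rho>) \<beta> = (\<lambda>Y. r * hodge_star k G \<rho> \<beta> Y)"
  by (simp add: hodge_star_def volume_form_def fun_eq_iff sum_distrib_left mult_ac)

lemma whitney_map_add:
  "whitney_map K k (c + d) \<sigma> x = (\<lambda>X. whitney_map K k c \<sigma> x X + whitney_map K k d \<sigma> x X)"
  by (simp add: whitney_map_def fun_eq_iff distrib_right sum.distrib)

lemma whitney_map_scale:
  "whitney_map K k (r *\<^sub>R c) \<sigma> x = (\<lambda>X. r * whitney_map K k c \<sigma> x X)"
  by (simp add: whitney_map_def fun_eq_iff sum_distrib_left mult_ac)

lemma linear_bary_diff: "linear (\<lambda>x. bary \<sigma> v x - bary \<sigma> v 0)"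
  by (auto simp: bary_def tet_param_def linear_iff algebra_simps)

text \<open>\<open>bary \<sigma> v\<close> is affine, so at every point its derivative is the same
  linear part.\<close>

lemma bary_has_derivative: "(bary \<sigma> v has_derivative (\<lambda>x. bary \<sigma> v x - bary \<sigma> v 0)) (at x)"
proof -
  have "((\<lambda>x. bary \<sigma> v x - bary \<sigma> v 0) has_derivative (\<lambda>x. bary \<sigma> v x - bary \<sigma> v 0)) (at x)"
    by (rule linear_imp_has_derivative[OF linear_bary_diff])
  from has_derivative_add[OF this has_derivative_const[of "bary \<sigma> v 0"]] show ?thesis by simp
qed

lemma continuous_on_bary: "continuous_on S (bary \<sigma> v)"
  using bary_has_derivative has_derivative_continuous
  by (metis continuous_at_imp_continuous_on)

text \<open>The differentials of barycentric coordinates are constant, so a Whitney form depends on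
  the point only through the factors \<open>bary\<close>.\<close>

lemma continuous_on_whitney_map: "continuous_on S (\<lambda>x. whitney_map K k c \<sigma> x X)"
proof -
  have "frechet_derivative (bary \<sigma> v) (at x) = (\<lambda>x. bary \<sigma> v x - bary \<sigma> v 0)" for v x
    by (rule frechet_derivative_at[OF bary_has_derivative, symmetric])
  then show ?thesis
    unfolding whitney_map_def whitney_simplex_form_def
    by (simp only:) (intro continuous_intros continuous_on_bary)
qed

definition whitney_integrand where
  "whitney_integrand \<A> g K h k u v \<sigma> x X =
     sgn (det (tet_jacobian \<A> h \<sigma> x)) * wedge k (3 - k) (whitney_map K k u \<sigma> x)
       (hodge_star k (tet_metric \<A> g h \<sigma> x) (tet_volume \<A> g h \<sigma> x) (whitney_map K k v \<sigma> x)) X"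

lemma whitney_integrand_set_integrable:
  assumes man: "closed_oriented_riemannian_3manifold M \<A> g"
    and tri: "smooth_triangulation M \<A> K h" and \<sigma>: "\<sigma> \<in> simplices K 3"
  shows "set_integrable lborel (interior std_tetrahedron) (\<lambda>x. whitney_integrand \<A> g K h k u v \<sigma> x X)"
proof (rule locally_extendable_set_integrable)
  show "locally_extendable std_tetrahedron (interior std_tetrahedron)
      (\<lambda>x. whitney_integrand \<A> g K h k u v \<sigma> x X)"
    \<comment> \<open>Used from right to left, the scaling rules push the sign through the wedge and
      the star onto \<open>tet_volume\<close>.\<close>
    unfolding whitney_integrand_def wedge_scale_right[symmetric] hodge_star_volume_scale[symmetric]
    unfolding wedge_def hodge_star_def volume_form_def
    by (intro locally_extendable_intros locally_extendable_tet_metric_inv[OF man tri \<sigma>]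
        locally_extendable_tet_volume[OF man tri \<sigma>]
        locally_extendable_continuous[OF continuous_on_whitney_map])
  show "compact std_tetrahedron"
    unfolding compact_eq_bounded_closed
  proof
    have "std_tetrahedron \<subseteq> cbox 0 (\<chi> i. 1)"
      by (auto simp: std_tetrahedron_def mem_box_cart forall_3)
    then show "bounded std_tetrahedron" by (meson bounded_cbox bounded_subset)
    show "closed std_tetrahedron"
      unfolding std_tetrahedron_def
      by (intro closed_Collect_conj closed_Collect_le continuous_intros)
  qed
qed (use interior_subset in auto)

lemma bilinear_whitney_inner:
  assumes man: "closed_oriented_riemannian_3manifold M \<A> g"
    and tri: "smooth_triangulation M \<A> K h"
  shows "bilinear (whitney_inner \<A> g K h k)"
proof -
  let ?X = "\<lambda>i::nat. if i = 0 then axis 1 1 else if i = 1 then axis 2 1 else axis 3 1 :: real^3"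
  have inner: "whitney_inner \<A> g K h k u v = (\<Sum>\<sigma>\<in>simplices K 3.
      LINT x:interior std_tetrahedron|lborel. whitney_integrand \<A> g K h k u v \<sigma> x ?X)" for u v
    by (simp add: whitney_inner_def integral_3form_def whitney_integrand_def)
  note int = whitney_integrand_set_integrable[OF man tri]
  have eqs:
    "whitney_integrand \<A> g K h k (u + u') v \<sigma> x X =
     whitney_integrand \<A> g K h k u v \<sigma> x X + whitney_integrand \<A> g K h k u' v \<sigma> x X"
    "whitney_integrand \<A> g K h k v (u + u') \<sigma> x X =
     whitney_integrand \<A> g K h k v u \<sigma> x X + whitney_integrand \<A> g K h k v u' \<sigma> x X"
    "whitney_integrand \<A> g K h k (r *\<^sub>R u) v \<sigma> x X = r * whitney_integrand \<A> g K h k u v \<sigma> x X"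
    "whitney_integrand \<A> g K h k v (r *\<^sub>R u) \<sigma> x X = r * whitney_integrand \<A> g K h k v u \<sigma> x X"
    for u u' v r \<sigma> x X
    by (simp_all add: whitney_integrand_def whitney_map_add whitney_map_scale hodge_star_add
        hodge_star_scale wedge_add_left wedge_add_right wedge_scale_left wedge_scale_right distrib_left)
  show ?thesis
    unfolding bilinear_def linear_iff
    by (auto simp: inner eqs set_integral_add(2) int sum.distrib sum_distrib_left)
qed

section \<open>Gauge and physical cochains\<close>

lemma nth_remove_index:
  assumes "i < length l" "j < length l - 1"
  shows "(take i l @ drop (Suc i) l) ! j = l ! (if j < i then j else Suc j)"
  using assms by (auto simp: nth_append min_def)

lemma sorted_list_of_set_remove_nth:
  assumes "finite s" "i < card s"
  shows "sorted_list_of_set (s - {sorted_list_of_set s ! i}) =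
    take i (sorted_list_of_set s) @ drop (Suc i) (sorted_list_of_set s)"
proof -
  let ?l = "sorted_list_of_set s"
  have i: "i < length ?l" using assms by simp
  have d: "?l = take i ?l @ ?l ! i # drop (Suc i) ?l" using i by (rule id_take_nth_drop)
  have "distinct (take i ?l @ ?l ! i # drop (Suc i) ?l)" using d by (metis distinct_sorted_list_of_set)
  then have "remove1 (?l ! i) (take i ?l @ ?l ! i # drop (Suc i) ?l) = take i ?l @ drop (Suc i) ?l"
    by (simp add: remove1_append)
  with d have "remove1 (?l ! i) ?l = take i ?l @ drop (Suc i) ?l" by simp
  then show ?thesis using sorted_list_of_set_remove[OF assms(1), of "?l ! i"] by simp
qed

text \<open>A face obtained by deleting two vertices arises in both orders of deletion. Deleting the
  smaller vertex first shifts the index of the larger one by one, so the two contributions have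
  opposite signs.\<close>

lemma coboundary_coboundary:
  assumes K: "simplicial_complex K"
  shows "coboundary K (Suc k) (coboundary K k c) = 0"
proof -
  have "(coboundary K (Suc k) (coboundary K k c)) $ s = 0" for s
  proof (cases "s \<in> simplices K (Suc (Suc k))")
    case True
    let ?l = "sorted_list_of_set s"
    define D where "D i j = c $ (s - {?l ! i} - {?l ! j})" for i j
    have s: "s \<in> K" "finite s" "card s = Suc (Suc (Suc k))"
      using True by (auto simp: simplices_def)
    \<comment> \<open>After vertex \<open>i\<close> is deleted, position \<open>j\<close> of the
      face holds vertex \<open>j\<close> of \<open>s\<close> if \<open>j < i\<close> and vertex
      \<open>j + 1\<close> otherwise.\<close>
    have face: "coboundary K k c $ (s - {?l ! i}) =
        (\<Sum>j\<le>Suc k. (-1) ^ j * D i (if j < i then j else Suc j))" if i: "i \<le> Suc (Suc k)" for i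
    proof -
      have "?l ! i \<in> s" using i s by (metis le_imp_less_Suc length_sorted_list_of_set nth_mem set_sorted_list_of_set)
      then have c: "card (s - {?l ! i}) = Suc (Suc k)" using s by simp
      have "s - {?l ! i} \<noteq> {}"
      proof
        assume "s - {?l ! i} = {}"
        then have "card (s - {?l ! i}) = 0" by (simp only: card.empty)
        with c show False by (simp only:)
      qed
      moreover have "s - {?l ! i} \<subseteq> s" by (rule Diff_subset)
      ultimately have "s - {?l ! i} \<in> K" using K s(1) unfolding simplicial_complex_def by metis
      then have m: "s - {?l ! i} \<in> simplices K (Suc k)" using c by (simp add: simplices_def)
      have "sorted_list_of_set (s - {?l ! i}) ! j = ?l ! (if j < i then j else Suc j)" if "j \<le> Suc k" for j
        using sorted_list_of_set_remove_nth[OF s(2), of i] nth_remove_index[of i ?l j] i that s by simp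
      with m show ?thesis by (simp add: coboundary_def D_def del: sum.atMost_Suc)
    qed
    let ?T = "\<lambda>(i, j). (-1) ^ (i + j) * D i (if j < i then j else Suc j)"
    let ?P = "{..Suc (Suc k)} \<times> {..Suc k}"
    let ?L = "{(i, j). j < i \<and> i \<le> Suc (Suc k)}"
    let ?U = "{(i, j). i \<le> j \<and> j \<le> Suc k}"
    have P: "?P = ?L \<union> ?U" "?L \<inter> ?U = {}" by auto
    have fin: "finite ?L" "finite ?U"
      by (rule finite_subset[of _ ?P]; auto)+
    have "coboundary K (Suc k) (coboundary K k c) $ s =
        (\<Sum>i\<le>Suc (Suc k). (-1) ^ i * (coboundary K k c $ (s - {?l ! i})))"
      using True by (simp add: coboundary_def[of K "Suc k"])
    also have "\<dots> = (\<Sum>i\<le>Suc (Suc k). \<Sum>j\<le>Suc k. ?T (i, j))"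
      by (intro sum.cong refl) (simp add: face sum_distrib_left power_add mult.assoc del: sum.atMost_Suc)
    also have "\<dots> = sum ?T ?P"
      by (simp add: sum.cartesian_product del: sum.atMost_Suc)
    also have "\<dots> = sum ?T ?L + sum ?T ?U"
      unfolding P(1) by (rule sum.union_disjoint[OF fin P(2)])
    also have "sum ?T ?U = (\<Sum>p\<in>?L. - ?T p)"
    \<comment> \<open>The pair \<open>(i, j)\<close> with \<open>i \<le> j\<close> deletes the
      vertices \<open>i\<close> and \<open>j + 1\<close>, as does \<open>(j + 1, i)\<close>; the
      exponents \<open>i + j\<close> and \<open>j + 1 + i\<close> differ by one.\<close>
    proof (rule sum.reindex_bij_witness[of _ "\<lambda>(i, j). (j, i - 1)" "\<lambda>(i, j). (Suc j, i)"])
      have "D i j = D j i" for i j by (simp add: D_def insert_commute flip: Diff_insert)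
      then show "- ?T ((\<lambda>(i, j). (Suc j, i)) p) = ?T p" if "p \<in> ?U" for p
        using that by (auto simp: power_add)
    qed auto
    finally show ?thesis by (simp add: sum_negf)
  qed (simp add: coboundary_def)
  then show ?thesis by (simp add: vec_eq_iff)
qed

lemma coboundary_in_cochains: "coboundary K k c \<in> cochains K (Suc k)"
  by (simp add: cochains_def coboundary_def)

lemma gauge_space_subset_cochains: "gauge_space K \<subseteq> cochains K 1"
  using coboundary_in_cochains by (auto simp: gauge_space_def)

lemma subspace_cochains: "subspace (cochains K k)"
  by (auto simp: subspace_def cochains_def)

lemma physical_space_subset_cochains: "physical_space \<A> g K h \<subseteq> cochains K 1"
proof -
  have "a + b \<in> cochains K 1" if "a \<in> cochains K 1" "b \<in> cochains K 1" for a b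
    using subspace_add[OF subspace_cochains that] .
  then show ?thesis
    by (auto simp: physical_space_def harmonic_space_def is_codiff_def)
qed

text \<open>A coboundary \<open>coboundary K 0 d\<close> pairs to 0 with a harmonic cochain because
  the codifferential of the latter is 0. Its pairing with a codifferential of \<open>w\<close>
  equals that of \<open>coboundary K 1 (coboundary K 0 d)\<close>, which is 0, with
  \<open>w\<close>.\<close>

lemma whitney_inner_gauge_physical:
  assumes man: "closed_oriented_riemannian_3manifold M \<A> g"
    and tri: "smooth_triangulation M \<A> K h"
    and y: "y \<in> gauge_space K" and x: "x \<in> physical_space \<A> g K h"
  shows "whitney_inner \<A> g K h 1 y x = 0"
proof -
  note bil = bilinear_whitney_inner[OF man tri]
  have K: "simplicial_complex K" using tri by (simp add: smooth_triangulation_def)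
  obtain d where d: "d \<in> cochains K 0" "y = coboundary K 0 d" using y by (auto simp: gauge_space_def)
  obtain a b w where ab: "x = a + b" "a \<in> harmonic_space \<A> g K h" "is_codiff \<A> g K h 1 w b"
    using x by (auto simp: physical_space_def)
  have "whitney_inner \<A> g K h 1 y a = whitney_inner \<A> g K h 0 d 0"
    using ab(2) d by (auto simp: harmonic_space_def is_codiff_def)
  moreover have "whitney_inner \<A> g K h 1 y b =
      whitney_inner \<A> g K h 2 (coboundary K 1 (coboundary K 0 d)) w"
    using ab(3) d coboundary_in_cochains[of K 0 d] by (simp add: is_codiff_def numeral_2_eq_2)
  ultimately show ?thesis
    using bilinear_radd[OF bil] bilinear_rzero[OF bil] bilinear_lzero[OF bil]
      coboundary_coboundary[OF K, of 0 d] by (simp add: ab(1))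
qed

section \<open>Linear changes of variables\<close>

lemma borel_measurable_linear:
  fixes T :: "'a::euclidean_space \<Rightarrow> 'b::euclidean_space"
  assumes "linear T"
  shows "T \<in> borel \<rightarrow>\<^sub>M borel"
  using assms by (intro borel_measurable_continuous_onI linear_continuous_on)
    (simp add: linear_conv_bounded_linear)

text \<open>Such a map only relabels coordinates, so preimages of boxes are boxes with the same side
  lengths. It serves for renaming an index type and for joining pairs into block vectors.\<close>

lemma lborel_distr_basis_bij:
  fixes \<phi> :: "'a::euclidean_space \<Rightarrow> 'b::euclidean_space"
  assumes lin: "linear \<phi>" and bij: "bij_betw \<phi> Basis Basis"
  shows "distr lborel borel \<phi> = lborel"
proof (rule lborel_eqI[symmetric])
  have \<phi>[measurable]: "\<phi> \<in> borel \<rightarrow>\<^sub>M borel"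
    by (rule borel_measurable_linear[OF lin])
  have coord: "\<phi> x \<bullet> \<phi> b = x \<bullet> b" if b: "b \<in> Basis" for x b
  proof -
    have "\<phi> x \<bullet> \<phi> b = \<phi> (\<Sum>c\<in>Basis. (x \<bullet> c) *\<^sub>R c) \<bullet> \<phi> b" by (simp add: euclidean_representation)
    also have "\<dots> = (\<Sum>c\<in>Basis. (x \<bullet> c) * (\<phi> c \<bullet> \<phi> b))"
      by (simp add: linear_sum[OF lin] linear_scale[OF lin] inner_sum_left)
    also have "\<dots> = (\<Sum>c\<in>Basis. if c = b then x \<bullet> c else 0)"
    proof (rule sum.cong[OF refl])
      fix c :: 'a assume c: "c \<in> Basis"
      have "\<phi> c \<in> Basis" "\<phi> b \<in> Basis" using bij b c by (auto simp: bij_betw_def)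
      moreover have "\<phi> c = \<phi> b \<longleftrightarrow> c = b"
        using bij b c by (auto simp: bij_betw_def inj_on_def)
      ultimately show "(x \<bullet> c) * (\<phi> c \<bullet> \<phi> b) = (if c = b then x \<bullet> c else 0)"
        by (simp add: inner_Basis)
    qed
    finally show ?thesis using b by simp
  qed
  fix l u :: 'b assume le: "\<And>b. b \<in> Basis \<Longrightarrow> l \<bullet> b \<le> u \<bullet> b"
  \<comment> \<open>The corners of the preimage box: the coordinate along \<open>b\<close> is that
    of the given corner along \<open>\<phi> b\<close>.\<close>
  define l' where "l' = (\<Sum>b\<in>Basis. (l \<bullet> \<phi> b) *\<^sub>R b)"
  define u' where "u' = (\<Sum>b\<in>Basis. (u \<bullet> \<phi> b) *\<^sub>R b)"
  have B: "\<phi> b \<in> Basis" if "b \<in> Basis" for b using bij that by (auto simp: bij_betw_def)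
  have "\<phi> -` box l u = box l' u'"
  proof (rule set_eqI)
    fix x
    have "x \<in> \<phi> -` box l u \<longleftrightarrow> (\<forall>b\<in>\<phi> ` Basis. l \<bullet> b < \<phi> x \<bullet> b \<and> \<phi> x \<bullet> b < u \<bullet> b)"
      using bij by (simp add: mem_box bij_betw_def)
    also have "\<dots> \<longleftrightarrow> x \<in> box l' u'"
      by (simp add: mem_box l'_def u'_def coord)
    finally show "x \<in> \<phi> -` box l u \<longleftrightarrow> x \<in> box l' u'" .
  qed
  then have "emeasure (distr lborel borel \<phi>) (box l u) = emeasure lborel (box l' u')"
    by (simp add: emeasure_distr)
  also have "\<dots> = (\<Prod>b\<in>Basis. (u' - l') \<bullet> b)"
    using le B by (intro emeasure_lborel_box) (simp add: l'_def u'_def)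
  also have "(\<Prod>b\<in>Basis. (u' - l') \<bullet> b) = (\<Prod>b\<in>Basis. (u - l) \<bullet> \<phi> b)"
    by (simp add: l'_def u'_def inner_diff_left)
  also have "\<dots> = (\<Prod>b\<in>Basis. (u - l) \<bullet> b)"
    by (rule prod.reindex_bij_betw[OF bij])
  finally show "emeasure (distr lborel borel \<phi>) (box l u) = (\<Prod>b\<in>Basis. (u - l) \<bullet> b)" .
qed simp

text \<open>The library proves the transformation formula for linear maps only for index types with a
  well-order. This copy of a finite type carries one.\<close>

typedef 'a wo = "UNIV :: 'a set" by simp

lemma bij_Rep_wo: "bij Rep_wo"
  by (metis Rep_wo_inject Rep_wo_inverse UNIV_I Abs_wo_inverse bij_def injI surj_def)

text \<open>Any injection into the naturals will do: the order pulled back along it is a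
  well-order.\<close>

definition wo_index :: "'a::finite wo \<Rightarrow> nat" where
  "wo_index = (SOME f. inj f)"

instance wo :: (finite) finite
proof
  show "finite (UNIV :: 'a wo set)"
    by (simp add: bij_betw_finite[OF bij_Rep_wo])
qed

lemma inj_wo_index: "inj wo_index"
proof -
  have "\<exists>f :: 'a wo \<Rightarrow> nat. inj f"
    using finite_imp_inj_to_nat_seg[of "UNIV :: 'a wo set"] by auto
  then show ?thesis unfolding wo_index_def by (rule someI_ex)
qed

instantiation wo :: (finite) wellorder
begin

definition "x \<le> y \<longleftrightarrow> wo_index x \<le> wo_index y"
definition "x < y \<longleftrightarrow> wo_index x < wo_index y"

instance
proof
  fix P :: "'a wo \<Rightarrow> bool" and a :: "'a wo"
  assume *: "\<And>x. (\<And>y. y < x \<Longrightarrow> P y) \<Longrightarrow> P x"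
  show "P a"
    by (induction a rule: measure_induct_rule[of wo_index]) (auto intro: * simp: less_wo_def)
qed (auto simp: less_eq_wo_def less_wo_def inj_wo_index[THEN inj_eq])

end

text \<open>Conjugation by \<open>f\<close> is a bijection between the permutations of the two index
  types that preserves signs, so the Leibniz sums agree term by term.\<close>

lemma det_reindex:
  fixes A :: "'a::comm_ring_1^'n^'n" and f :: "'m::finite \<Rightarrow> 'n"
  assumes f: "bij f"
  shows "det (\<chi> i j. A $ f i $ f j) = det A"
proof -
  have perm: "map_permutation UNIV (inv f) p permutes UNIV" if "p permutes UNIV" for p
    by (rule map_permutation_permutes[OF bij_imp_bij_inv[OF f] that])
  have inj: "inj (inv f)" using bij_imp_bij_inv[OF f] by (simp add: bij_def)
  have ap: "map_permutation UNIV (inv f) p i = inv f (p (f i))" for p i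
    using map_permutation_apply[of "inv f" UNIV "f i" p] inj f by (simp add: bij_def)
  have bij: "bij_betw (map_permutation UNIV (inv f)) {p. p permutes UNIV} {p. p permutes UNIV}"
  proof (rule bij_betwI[where g = "map_permutation UNIV f"])
    show "map_permutation UNIV (inv f) \<in> {p. p permutes UNIV} \<rightarrow> {p. p permutes UNIV}"
      using perm by auto
    show "map_permutation UNIV f \<in> {p. p permutes UNIV} \<rightarrow> {p. p permutes UNIV}"
      using map_permutation_permutes[OF f] by auto
    have ap': "map_permutation UNIV f p i = f (p (inv f i))" for p i
      using map_permutation_apply[of f UNIV "inv f i" p] f by (simp add: bij_def surj_f_inv_f)
    show "map_permutation UNIV f (map_permutation UNIV (inv f) p) = p" for p
      using f by (simp add: fun_eq_iff ap ap' bij_def surj_f_inv_f)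
    show "map_permutation UNIV (inv f) (map_permutation UNIV f p) = p" for p
      using f by (simp add: fun_eq_iff ap ap' bij_def surj_f_inv_f)
  qed
  have "det (\<chi> i j. A $ f i $ f j) = (\<Sum>p | p permutes (UNIV :: 'n set).
      of_int (sign (map_permutation UNIV (inv f) p)) *
      (\<Prod>i\<in>UNIV. A $ f i $ f (map_permutation UNIV (inv f) p i)))"
    unfolding det_def by (subst sum.reindex_bij_betw[OF bij, symmetric]) simp
  also have "\<dots> = (\<Sum>p | p permutes (UNIV :: 'n set). of_int (sign p) * (\<Prod>i\<in>UNIV. A $ i $ p i))"
  proof (rule sum.cong[OF refl])
    fix p :: "'n \<Rightarrow> 'n" assume p: "p \<in> {p. p permutes UNIV}"
    have "sign (map_permutation UNIV (inv f) p) = sign p"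
      using p inj by (intro sign_map_permutation) auto
    moreover have "(\<Prod>i\<in>UNIV. A $ f i $ f (map_permutation UNIV (inv f) p i)) =
        (\<Prod>i\<in>UNIV. A $ f i $ p (f i))"
      using f by (simp add: ap bij_def surj_f_inv_f)
    moreover have "\<dots> = (\<Prod>i\<in>UNIV. A $ i $ p i)"
      by (rule prod.reindex_bij_betw[OF f])
    ultimately show "of_int (sign (map_permutation UNIV (inv f) p)) *
      (\<Prod>i\<in>UNIV. A $ f i $ f (map_permutation UNIV (inv f) p i)) =
      of_int (sign p) * (\<Prod>i\<in>UNIV. A $ i $ p i)" by simp
  qed
  finally show ?thesis by (simp add: det_def)
qed

lemma measurable_matrix_vector_mult [measurable]:
  "(\<lambda>x. A *v x) \<in> borel \<rightarrow>\<^sub>M (borel :: (real^'m) measure)" for A :: "real^'n^'m"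
  by (rule borel_measurable_linear[OF matrix_vector_mul_linear])

text \<open>It suffices to compare on boxes. The preimage of a box under \<open>A\<close> is its
  image under the inverse, whose volume is scaled by \<open>\<bar>det (matrix_inv A)\<bar>\<close>;
  the density undoes this factor.\<close>

lemma lborel_eq_density_linear_wellorder:
  fixes A :: "real^'n::{finite,wellorder}^'n::{finite,wellorder}"
  assumes A: "det A \<noteq> 0"
  shows "lborel = density (distr lborel borel ((*v) A)) (\<lambda>_. ennreal \<bar>det A\<bar>)"
proof (rule lborel_eqI)
  fix l u :: "real^'n::{finite,wellorder}" assume le: "\<And>b. b \<in> Basis \<Longrightarrow> l \<bullet> b \<le> u \<bullet> b"
  let ?B = "matrix_inv A"
  have inv: "A ** ?B = mat 1" "?B ** A = mat 1"
    using A by (simp_all add: matrix_inv_left matrix_inv_right invertible_det_nz)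
  have "(*v) A -` box l u = (*v) ?B ` box l u"
  proof
    show "(*v) A -` box l u \<subseteq> (*v) ?B ` box l u"
    proof
      fix x assume "x \<in> (*v) A -` box l u"
      moreover have "x = ?B *v (A *v x)" by (simp add: matrix_vector_mul_assoc inv)
      ultimately show "x \<in> (*v) ?B ` box l u" by blast
    qed
    show "(*v) ?B ` box l u \<subseteq> (*v) A -` box l u"
      by (auto simp: matrix_vector_mul_assoc inv)
  qed
  moreover have "(*v) A -` box l u \<in> sets lborel"
    using measurable_sets[OF measurable_matrix_vector_mult[of A], of "box l u"] by simp
  moreover have "emeasure lebesgue ((*v) ?B ` box l u) = ennreal (\<bar>det ?B\<bar> * measure lebesgue (box l u))"
    using measurable_linear_image[of "(*v) ?B" "box l u"] measure_linear_image[of "(*v) ?B" "box l u"]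
    by (simp add: emeasure_eq_measure2 matrix_of_matrix_vector_mul lmeasurable_box)
  \<comment> \<open>The formula for linear images is about Lebesgue measure, which agrees with
    \<open>lborel\<close> on this Borel set.\<close>
  moreover from calculation(2) have
    "emeasure lborel ((*v) A -` box l u) = emeasure lebesgue ((*v) A -` box l u)"
    by simp
  ultimately have "emeasure lborel ((*v) A -` box l u) = ennreal (\<bar>det ?B\<bar> * measure lebesgue (box l u))"
    by simp
  moreover have "measure lebesgue (box l u) = (\<Prod>b\<in>Basis. (u - l) \<bullet> b)"
    using le by (simp add: measure_lborel_box_eq)
  moreover have "\<bar>det A\<bar> * \<bar>det ?B\<bar> = 1"
    using inv by (metis abs_mult abs_one det_I det_mul)
  ultimately show "emeasure (density (distr lborel borel ((*v) A)) (\<lambda>_. ennreal \<bar>det A\<bar>)) (box l u) =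
      (\<Prod>b\<in>Basis. (u - l) \<bullet> b)"
    by (simp add: emeasure_density_const emeasure_distr flip: ennreal_mult')
       (simp flip: mult.assoc)
qed simp

text \<open>The relabelling \<open>r\<close> preserves Lebesgue measure and intertwines
  \<open>A\<close> with its copy \<open>A'\<close> over the well-ordered index type, which has the
  same determinant.\<close>

lemma nn_integral_lborel_linear:
  fixes A :: "real^'n^'n" and f :: "real^'n \<Rightarrow> ennreal"
  assumes A: "det A \<noteq> 0" and f[measurable]: "f \<in> borel_measurable borel"
  shows "(\<integral>\<^sup>+x. f x \<partial>lborel) = ennreal \<bar>det A\<bar> * (\<integral>\<^sup>+x. f (A *v x) \<partial>lborel)"
proof -
  define r :: "real^'n wo \<Rightarrow> real^'n" where "r z = (\<chi> i. z $ Abs_wo i)" for z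
  define A' where "A' = (\<chi> i j. A $ Rep_wo i $ Rep_wo j)"
  have lin: "linear r" by (auto simp: linear_iff r_def vec_eq_iff)
  have ax: "r (axis i u) = axis (Rep_wo i) u" for i u
    by (auto simp: r_def axis_def vec_eq_iff Abs_wo_inverse Rep_wo_inverse)
  have "bij_betw r Basis Basis"
    unfolding bij_betw_def
  proof
    show "inj_on r Basis"
      by (rule inj_onI) (metis (no_types, lifting) Abs_wo_inverse Rep_wo_inverse UNIV_I r_def vec_eq_iff vec_lambda_beta)
    show "r ` Basis = Basis"
      by (auto simp: Basis_vec_def ax image_iff) (metis Abs_wo_inverse UNIV_I ax)
  qed
  from lborel_distr_basis_bij[OF lin this] have r: "distr lborel borel r = lborel" .
  have mr[measurable]: "r \<in> borel \<rightarrow>\<^sub>M borel"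
    by (rule borel_measurable_linear[OF lin])
  have comm: "r (A' *v z) = A *v r z" for z
    by (simp add: vec_eq_iff matrix_vector_mult_def r_def A'_def Abs_wo_inverse)
      (rule allI, subst sum.reindex_bij_betw[OF bij_Rep_wo, symmetric], simp add: Rep_wo_inverse)
  have det: "det A' = det A" unfolding A'_def by (rule det_reindex[OF bij_Rep_wo])
  have "(\<integral>\<^sup>+x. f x \<partial>lborel) = (\<integral>\<^sup>+z. f (r z) \<partial>lborel)"
    by (subst r[symmetric]) (simp add: nn_integral_distr)
  also have "\<dots> = ennreal \<bar>det A\<bar> * (\<integral>\<^sup>+z. f (r (A' *v z)) \<partial>lborel)"
    using A det
    by (subst lborel_eq_density_linear_wellorder[of A'])
       (simp_all add: nn_integral_density nn_integral_distr nn_integral_cmult)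
  also have "(\<integral>\<^sup>+z. f (r (A' *v z)) \<partial>lborel) = (\<integral>\<^sup>+x. f (A *v x) \<partial>lborel)"
    using nn_integral_distr[of r lborel borel "\<lambda>x. f (A *v x)"] by (simp add: r comm)
  finally show ?thesis .
qed

section \<open>Gaussian densities\<close>

lemma inner_transpose_mult: "x \<bullet> (transpose B *v w) = (B *v x) \<bullet> w" for B :: "real^'n^'m"
proof -
  have "x \<bullet> (transpose B *v w) = (w v* B) \<bullet> x" by (simp add: transpose_matrix_vector inner_commute)
  also have "\<dots> = w \<bullet> (B *v x)" by (rule dot_lmul_matrix)
  finally show ?thesis by (simp add: inner_commute)
qed

lemma pos_def_matrix_symmetric_inner:
  assumes "pos_def_matrix P"
  shows "x \<bullet> (P *v y) = y \<bullet> (P *v x)"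
proof -
  have "transpose P = P" using assms by (simp add: pos_def_matrix_def)
  then have "x \<bullet> (P *v y) = (P *v x) \<bullet> y" using inner_transpose_mult[of x P y] by (simp only:)
  then show ?thesis by (simp only: inner_commute[of "P *v x"])
qed

lemma pos_def_matrix_scaleR:
  assumes "pos_def_matrix P" "0 < r"
  shows "pos_def_matrix (r *\<^sub>R P)"
proof -
  have "transpose (r *\<^sub>R P) = r *\<^sub>R transpose P" by (simp add: transpose_def vec_eq_iff)
  moreover have "x \<bullet> ((r *\<^sub>R P) *v x) = r * (x \<bullet> (P *v x))" for x
    by (simp only: scaleR_matrix_vector_assoc[symmetric] inner_scaleR_right)
  ultimately show ?thesis using assms by (simp add: pos_def_matrix_def)
qed

lemma pos_def_matrix_inner_pos: "pos_def_matrix P \<Longrightarrow> x \<noteq> 0 \<Longrightarrow> 0 < x \<bullet> (P *v x)"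
  by (simp add: pos_def_matrix_def)

lemma pos_def_matrix_inner_nonneg: "pos_def_matrix P \<Longrightarrow> 0 \<le> x \<bullet> (P *v x)"
  using pos_def_matrix_inner_pos[of P x] by (cases "x = 0") auto

text \<open>Gram-Schmidt for the inner product given by \<open>P\<close>. The induction runs over
  sets of indices, so that for \<open>S = UNIV\<close> the family is ready to serve as the columns
  of a square matrix.\<close>

lemma pos_def_matrix_orthonormal_family:
  fixes P :: "real^'n^'n" and S :: "'n set"
  assumes P: "pos_def_matrix P"
  shows "\<exists>b. \<forall>i\<in>S. \<forall>j\<in>S. b i \<bullet> (P *v b j) = (if i = j then 1 else 0)"
proof -
  have "finite S" by simp
  then show ?thesis
  proof (induction S)
    case (insert k S)
    then obtain b where b: "\<And>i j. i \<in> S \<Longrightarrow> j \<in> S \<Longrightarrow> b i \<bullet> (P *v b j) = (if i = j then 1 else 0)"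
      by blast
    \<comment> \<open>Fewer vectors than the dimension cannot span, which leaves a vector to
      orthogonalize.\<close>
    have "dim (span (b ` S)) < DIM(real^'n)"
    proof -
      have "dim (span (b ` S)) \<le> card (b ` S)" by (simp add: dim_le_card')
      also have "\<dots> \<le> card S" using insert(1) by (rule card_image_le)
      also have "\<dots> < card (insert k S)" using insert by simp
      also have "\<dots> \<le> CARD('n)" by (rule card_mono) auto
      finally show ?thesis by simp
    qed
    then obtain x where x: "x \<notin> span (b ` S)" by (metis UNIV_eq_I dim_UNIV less_irrefl)
    define w where "w = x - (\<Sum>i\<in>S. (b i \<bullet> (P *v x)) *\<^sub>R b i)"
    have "w \<noteq> 0"
    proof
      assume "w = 0"
      then have "x = (\<Sum>i\<in>S. (b i \<bullet> (P *v x)) *\<^sub>R b i)" by (simp add: w_def)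
      also have "\<dots> \<in> span (b ` S)" by (intro span_sum span_scale span_base) auto
      finally show False using x by simp
    qed
    then have pos: "0 < w \<bullet> (P *v w)" by (rule pos_def_matrix_inner_pos[OF P])
    have orth: "b j \<bullet> (P *v w) = 0" if "j \<in> S" for j
    proof -
      have "b j \<bullet> (P *v w) = b j \<bullet> (P *v x) - (\<Sum>i\<in>S. (b i \<bullet> (P *v x)) * (b j \<bullet> (P *v b i)))"
        by (simp add: w_def matrix_vector_mult_diff_distrib inner_diff_right inner_sum_right
            linear_sum[OF matrix_vector_mul_linear] linear_scale[OF matrix_vector_mul_linear])
      also have "(\<Sum>i\<in>S. (b i \<bullet> (P *v x)) * (b j \<bullet> (P *v b i))) =
          (\<Sum>i\<in>S. if i = j then b i \<bullet> (P *v x) else 0)"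
        using that by (intro sum.cong refl) (simp add: b)
      finally show ?thesis using that insert(1) by simp
    qed
    define v where "v = (1 / sqrt (w \<bullet> (P *v w))) *\<^sub>R w"
    have v: "v \<bullet> (P *v v) = 1" "\<And>j. j \<in> S \<Longrightarrow> b j \<bullet> (P *v v) = 0"
      using pos orth by (simp_all add: v_def linear_scale[OF matrix_vector_mul_linear])
    have v': "v \<bullet> (P *v b j) = 0" if "j \<in> S" for j
      using v(2)[OF that] pos_def_matrix_symmetric_inner[OF P, of v "b j"] by simp
    show ?case
      using insert(2) b v v' by (intro exI[of _ "b(k := v)"]) auto
  qed simp
qed

text \<open>With orthonormal columns for the form \<open>P\<close>, the matrix satisfies
  \<open>transpose B ** P ** B = mat 1\<close>. The substitution by \<open>B\<close> thus turns
  every Gaussian integral into the standard one, and the determinants account for the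
  constant.\<close>

lemma pos_def_matrix_factorization:
  fixes P :: "real^'n^'n"
  assumes P: "pos_def_matrix P"
  obtains B where "\<And>x. (B *v x) \<bullet> (P *v (B *v x)) = x \<bullet> x" "(det B)\<^sup>2 * det P = 1"
proof -
  obtain b where b: "\<And>i j :: 'n. b i \<bullet> (P *v b j) = (if i = j then 1 else 0)"
    using pos_def_matrix_orthonormal_family[OF P, of UNIV] by auto
  define B :: "real^'n^'n" where "B = (\<chi> i j. b j $ i)"
  have col: "column j B = b j" for j by (simp add: B_def column_def)
  have "(transpose B ** P ** B) $ i $ j = mat 1 $ i $ j" for i j
  proof -
    have "(transpose B ** P ** B) $ i $ j = (transpose B ** (P ** B)) $ i $ j"
      by (simp add: matrix_mul_assoc)
    also have "\<dots> = column i B \<bullet> (P *v column j B)"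
      by (simp add: transpose_def column_def matrix_matrix_mult_def matrix_vector_mult_def inner_vec_def)
    finally show ?thesis using b by (simp add: col mat_def)
  qed
  then have BPB: "transpose B ** P ** B = mat 1" by (simp add: vec_eq_iff)
  have "(B *v x) \<bullet> (P *v (B *v x)) = x \<bullet> ((transpose B ** P ** B) *v x)" for x
    by (simp only: inner_transpose_mult[symmetric] matrix_vector_mul_assoc matrix_mul_assoc)
  then have "(B *v x) \<bullet> (P *v (B *v x)) = x \<bullet> x" for x by (simp add: BPB)
  moreover have "(det B)\<^sup>2 * det P = 1"
    using arg_cong[OF BPB, of det] by (simp add: det_mul power2_eq_square mult_ac)
  ultimately show thesis by (rule that)
qed

lemma pos_def_matrix_det_pos:
  fixes P :: "real^'n^'n"
  assumes "pos_def_matrix P"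
  shows "0 < det P"
proof -
  obtain B :: "real^'n^'n" where "(det B)\<^sup>2 * det P = 1" by (rule pos_def_matrix_factorization[OF assms]) blast
  then show ?thesis
    by (metis not_one_le_zero mult_nonneg_nonpos not_less zero_le_power2)
qed

lemma pos_def_matrix_inverse:
  fixes S :: "real^'n^'n"
  assumes S: "pos_def_matrix S"
  shows "pos_def_matrix (matrix_inv S)" "det (matrix_inv S) = inverse (det S)"
    "S *v (matrix_inv S *v x) = x"
proof -
  have inv: "S ** matrix_inv S = mat 1" "matrix_inv S ** S = mat 1"
    using pos_def_matrix_invertible[OF S] by (simp_all add: matrix_inv_left matrix_inv_right)
  show "det (matrix_inv S) = inverse (det S)"
    using arg_cong[OF inv(1), of det] by (simp add: det_mul inverse_unique)
  show SS: "S *v (matrix_inv S *v x) = x" for x by (simp add: matrix_vector_mul_assoc inv)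
  have "transpose (matrix_inv S) ** S = mat 1"
    using arg_cong[OF inv(1), of transpose] S by (simp add: matrix_transpose_mul pos_def_matrix_def)
  then have "transpose (matrix_inv S) ** S ** matrix_inv S = matrix_inv S" by simp
  then have "transpose (matrix_inv S) = matrix_inv S" by (simp add: inv flip: matrix_mul_assoc)
  moreover have "0 < x \<bullet> (matrix_inv S *v x)" if "x \<noteq> 0" for x
  proof -
    have "matrix_inv S *v x \<noteq> 0" using SS[of x] that by (metis matrix_vector_mult_0_right)
    from pos_def_matrix_inner_pos[OF S this] show ?thesis by (simp add: SS inner_commute)
  qed
  ultimately show "pos_def_matrix (matrix_inv S)" by (simp add: pos_def_matrix_def)
qed

section \<open>Gaussian integrals, moments and logarithms\<close>

lemma nn_integral_exp_norm_squared:
  "(\<integral>\<^sup>+(x::real^'n). ennreal (exp (- (x \<bullet> x) / 2)) \<partial>lborel) = ennreal (sqrt (2 * pi) ^ CARD('n))"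
proof -
  have one: "(\<integral>\<^sup>+x. ennreal (exp (- x\<^sup>2 / 2)) \<partial>lborel) = ennreal (sqrt (2 * pi))"
  proof -
    have "(\<integral>\<^sup>+x. ennreal (exp (- x\<^sup>2 / 2)) \<partial>lborel) =
        (\<integral>\<^sup>+x. ennreal (sqrt (2 * pi)) * ennreal (std_normal_density x) \<partial>lborel)"
      by (intro nn_integral_cong) (simp add: std_normal_density_def flip: ennreal_mult)
    also have "\<dots> = ennreal (sqrt (2 * pi)) * (\<integral>\<^sup>+x. ennreal (std_normal_density x) \<partial>lborel)"
      by (rule nn_integral_cmult) simp
    also have "(\<integral>\<^sup>+x. ennreal (std_normal_density x) \<partial>lborel) = 1"
      using prob_space.emeasure_space_1[OF prob_space_normal_density[of 1 0]]
      by (simp add: emeasure_density)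
    finally show ?thesis by simp
  qed
  have "(\<integral>\<^sup>+(x::real^'n). ennreal (exp (- (x \<bullet> x) / 2)) \<partial>lborel) =
      (\<integral>\<^sup>+(x::real^'n). (\<Prod>b\<in>Basis. ennreal (exp (- (x \<bullet> b)\<^sup>2 / 2))) \<partial>lborel)"
  proof (rule nn_integral_cong)
    fix x :: "real^'n"
    have "exp (- (x \<bullet> x) / 2) = (\<Prod>b\<in>Basis. exp (- (x \<bullet> b)\<^sup>2 / 2))"
      unfolding euclidean_inner[of x x]
      by (simp add: exp_sum[symmetric] sum_negf sum_divide_distrib power2_eq_square)
    then show "ennreal (exp (- (x \<bullet> x) / 2)) = (\<Prod>b\<in>Basis. ennreal (exp (- (x \<bullet> b)\<^sup>2 / 2)))"
      by (simp add: prod_ennreal)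
  qed
  also have "\<dots> = (\<Prod>b\<in>(Basis :: (real^'n) set). \<integral>\<^sup>+x. ennreal (exp (- x\<^sup>2 / 2)) \<partial>lborel)"
    by (rule nn_integral_lborel_prod) auto
  finally show ?thesis by (simp only: one prod_constant) (simp add: ennreal_power)
qed

lemma nn_integral_lborel_translation:
  fixes f :: "'a::euclidean_space \<Rightarrow> ennreal"
  assumes [measurable]: "f \<in> borel_measurable borel"
  shows "(\<integral>\<^sup>+x. f (x - m) \<partial>lborel) = (\<integral>\<^sup>+x. f x \<partial>lborel)"
proof -
  have "(\<integral>\<^sup>+x. f x \<partial>lborel) = (\<integral>\<^sup>+x. f x \<partial>distr lborel borel ((+) (- m)))"
    by (simp add: lborel_distr_plus)
  also have "\<dots> = (\<integral>\<^sup>+x. f (x - m) \<partial>lborel)"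
    by (simp add: nn_integral_distr)
  finally show ?thesis ..
qed

lemma quadratic_form_measurable [measurable]:
  "(\<lambda>x. (x - m) \<bullet> (P *v (x - m))) \<in> borel_measurable borel" for P :: "real^'n^'n"
  by (intro borel_measurable_continuous_onI continuous_intros
      linear_continuous_on_compose[OF _ matrix_vector_mul_linear])

text \<open>Translation removes \<open>m\<close>, and the substitution from
  \<open>pos_def_matrix_factorization\<close> reduces to the standard exponent at the price of
  \<open>\<bar>det B\<bar> = sqrt (1 / det P)\<close>.\<close>

lemma nn_integral_exp_quadratic:
  fixes P :: "real^'n^'n"
  assumes P: "pos_def_matrix P"
  shows "(\<integral>\<^sup>+x. ennreal (exp (- ((x - m) \<bullet> (P *v (x - m))) / 2)) \<partial>lborel) =
    ennreal (sqrt ((2 * pi) ^ CARD('n) / det P))"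
proof -
  obtain B where B: "\<And>x. (B *v x) \<bullet> (P *v (B *v x)) = x \<bullet> x" "(det B)\<^sup>2 * det P = 1"
    using pos_def_matrix_factorization[OF P] by metis
  have [measurable]: "(\<lambda>x. x \<bullet> (P *v x)) \<in> borel_measurable borel"
    using quadratic_form_measurable[of 0 P] by simp
  have "(\<integral>\<^sup>+x. ennreal (exp (- ((x - m) \<bullet> (P *v (x - m))) / 2)) \<partial>lborel) =
      (\<integral>\<^sup>+x. ennreal (exp (- (x \<bullet> (P *v x)) / 2)) \<partial>lborel)"
    by (rule nn_integral_lborel_translation[of "\<lambda>x. ennreal (exp (- (x \<bullet> (P *v x)) / 2))"]) simp
  also have "\<dots> = ennreal \<bar>det B\<bar> * (\<integral>\<^sup>+(x::real^'n). ennreal (exp (- (x \<bullet> x) / 2)) \<partial>lborel)"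
    using B(2) by (subst nn_integral_lborel_linear[of B]) (auto simp: B(1))
  also have "\<dots> = ennreal (\<bar>det B\<bar> * sqrt (2 * pi) ^ CARD('n))"
    by (simp only: nn_integral_exp_norm_squared) (simp add: ennreal_mult)
  also have "\<bar>det B\<bar> * sqrt (2 * pi) ^ CARD('n) = sqrt ((2 * pi) ^ CARD('n) / det P)"
  proof -
    have "(det B)\<^sup>2 = 1 / det P" using B(2) pos_def_matrix_det_pos[OF P] by (simp add: field_simps)
    then have "\<bar>det B\<bar> = sqrt (1 / det P)" by (metis real_sqrt_abs)
    then show ?thesis by (simp only: real_sqrt_divide real_sqrt_power real_sqrt_one times_divide_eq_left mult_1)
  qed
  finally show ?thesis .
qed

definition gaussian_density :: "real^'n \<Rightarrow> real^'n^'n \<Rightarrow> real^'n \<Rightarrow> real" where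
  "gaussian_density m S x =
     exp (- ((x - m) \<bullet> (matrix_inv S *v (x - m))) / 2) / sqrt ((2 * pi) ^ CARD('n) * det S)"

lemma gaussian_eq_density: "gaussian m S = density lborel (\<lambda>x. ennreal (gaussian_density m S x))"
  by (simp add: gaussian_def gaussian_density_def)

lemma gaussian_density_measurable [measurable]: "gaussian_density m S \<in> borel_measurable borel"
  unfolding gaussian_density_def[abs_def] by measurable

lemma gaussian_density_pos: "pos_def_matrix S \<Longrightarrow> 0 < gaussian_density m S x"
  by (simp add: gaussian_density_def pos_def_matrix_det_pos)

lemma nn_integral_gaussian_density:
  assumes S: "pos_def_matrix S"
  shows "(\<integral>\<^sup>+x. ennreal (gaussian_density m S x) \<partial>lborel) = 1"
proof -
  let ?c = "sqrt ((2 * pi) ^ CARD('a) * det S)"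
  have c: "0 < ?c" using pos_def_matrix_det_pos[OF S] by simp
  have "(\<integral>\<^sup>+x. ennreal (gaussian_density m S x) \<partial>lborel) =
      (\<integral>\<^sup>+x. ennreal (exp (- ((x - m) \<bullet> (matrix_inv S *v (x - m))) / 2)) * ennreal (1 / ?c) \<partial>lborel)"
    by (intro nn_integral_cong) (simp add: gaussian_density_def flip: ennreal_mult')
  also have "\<dots> = (\<integral>\<^sup>+x. ennreal (exp (- ((x - m) \<bullet> (matrix_inv S *v (x - m))) / 2)) \<partial>lborel) * ennreal (1 / ?c)"
    by (rule nn_integral_multc) simp
  also have "\<dots> = ennreal ?c * ennreal (1 / ?c)"
    by (simp only: nn_integral_exp_quadratic[OF pos_def_matrix_inverse(1)[OF S]]
        pos_def_matrix_inverse(2)[OF S] divide_inverse[of _ "inverse _"] inverse_inverse_eq)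
  also have "\<dots> = 1" using pos_def_matrix_det_pos[OF S] by (simp flip: ennreal_mult)
  finally show ?thesis .
qed

text \<open>Half of the exponent absorbs the quadratic factor; the other half is again a Gaussian
  exponent, for the matrix \<open>(1/2) *\<^sub>R matrix_inv S\<close>, and is integrable.\<close>

lemma gaussian_density_quadratic_integrable:
  fixes S :: "real^'n^'n"
  assumes S: "pos_def_matrix S"
  shows "integrable lborel (\<lambda>x. gaussian_density m S x * (1 + (norm x)\<^sup>2))"
proof -
  let ?P = "matrix_inv S"
  let ?Q = "\<lambda>x. (x - m) \<bullet> (?P *v (x - m))"
  have P: "pos_def_matrix ?P" by (rule pos_def_matrix_inverse[OF S])
  obtain B where B: "\<And>x. (B *v x) \<bullet> (?P *v (B *v x)) = x \<bullet> x" "(det B)\<^sup>2 * det ?P = 1"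
    using pos_def_matrix_factorization[OF P] by metis
  obtain k where k: "0 < k" "\<And>x. norm (B *v x) \<le> norm x * k"
    using bounded_linear.pos_bounded[OF matrix_vector_mul_bounded_linear[of B]] by blast
  \<comment> \<open>Coercivity of the quadratic form: for \<open>x = B *v z\<close> its value is
    \<open>z \<bullet> z\<close>, while \<open>norm x\<close> is at most
    \<open>k * norm z\<close>.\<close>
  have low: "(norm x)\<^sup>2 \<le> k\<^sup>2 * (x \<bullet> (?P *v x))" for x
  proof -
    have "invertible B" using B(2) by (auto simp: invertible_det_nz)
    then have "x = B *v (matrix_inv B *v x)" by (simp add: matrix_vector_mul_assoc matrix_inv_right)
    then obtain z where z: "x = B *v z" by blast
    have "(norm x)\<^sup>2 \<le> (norm z * k)\<^sup>2" unfolding z by (intro power_mono k) simp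
    then show ?thesis by (simp add: z B(1) power_mult_distrib power2_norm_eq_inner mult.commute)
  qed
  \<comment> \<open>The factor 4 comes from \<open>1 + q \<le> 4 * exp (q / 4)\<close>, the two
    factors 2 from \<open>(a + b)\<^sup>2 \<le> 2 * a\<^sup>2 + 2 * b\<^sup>2\<close>, and
    \<open>k\<^sup>2\<close> from \<open>low\<close>.\<close>
  define C where "C = 4 * (1 + 2 * (norm m)\<^sup>2 + 2 * k\<^sup>2)"
  have bound: "exp (- ?Q x / 2) * (1 + (norm x)\<^sup>2) \<le> C * exp (- ((x - m) \<bullet> (((1/2) *\<^sub>R ?P) *v (x - m))) / 2)" for x
  proof -
    have Q: "0 \<le> ?Q x" by (rule pos_def_matrix_inner_nonneg[OF P])
    have "(norm x)\<^sup>2 \<le> (norm (x - m) + norm m)\<^sup>2"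
      by (intro power_mono) (use norm_triangle_sub[of x m] in auto)
    also have "\<dots> \<le> 2 * (norm (x - m))\<^sup>2 + 2 * (norm m)\<^sup>2"
      using sum_squares_bound[of "norm (x - m)" "norm m"] by (simp add: power2_sum)
    also have "\<dots> \<le> 2 * k\<^sup>2 * ?Q x + 2 * (norm m)\<^sup>2" using low[of "x - m"] by simp
    finally have "1 + (norm x)\<^sup>2 \<le> 1 + 2 * (norm m)\<^sup>2 + 2 * k\<^sup>2 * ?Q x" by simp
    also have "\<dots> \<le> (1 + 2 * (norm m)\<^sup>2 + 2 * k\<^sup>2) * (1 + ?Q x)"
    proof -
      have "1 + 2 * a + b * q \<le> (1 + 2 * a + b) * (1 + q)" if "0 \<le> a" "0 \<le> b" "0 \<le> q" for a b q :: real
        using that by (simp add: algebra_simps)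
      from this[OF _ _ Q] show ?thesis by simp
    qed
    also have "\<dots> \<le> (1 + 2 * (norm m)\<^sup>2 + 2 * k\<^sup>2) * (4 * exp (?Q x / 4))"
    proof (intro mult_left_mono)
      show "1 + ?Q x \<le> 4 * exp (?Q x / 4)" using exp_ge_add_one_self[of "?Q x / 4"] by linarith
    qed simp
    finally have "1 + (norm x)\<^sup>2 \<le> C * exp (?Q x / 4)" by (simp add: C_def algebra_simps)
    then have "exp (- ?Q x / 2) * (1 + (norm x)\<^sup>2) \<le> exp (- ?Q x / 2) * (C * exp (?Q x / 4))"
      by (intro mult_left_mono) auto
    also have "\<dots> = C * exp (- ?Q x / 2 + ?Q x / 4)" by (simp only: exp_add mult_ac)
    also have "- ?Q x / 2 + ?Q x / 4 = - ((x - m) \<bullet> (((1/2) *\<^sub>R ?P) *v (x - m))) / 2"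
      by (simp add: scaleR_matrix_vector_assoc[symmetric])
    finally show ?thesis .
  qed
  have "pos_def_matrix ((1/2) *\<^sub>R ?P)"
    by (rule pos_def_matrix_scaleR[OF P]) simp
  from nn_integral_exp_quadratic[OF this, of m]
  have i: "integrable lborel (\<lambda>x. exp (- ((x - m) \<bullet> (((1/2) *\<^sub>R ?P) *v (x - m))) / 2))"
    by (intro integrableI_nonneg) auto
  have "integrable lborel (\<lambda>x. exp (- ?Q x / 2) * (1 + (norm x)\<^sup>2))"
    by (rule Bochner_Integration.integrable_bound[OF integrable_mult_right[OF i, of C]])
      (use bound in \<open>auto simp: abs_mult C_def intro!: order_trans[OF bound]\<close>)
  then have "integrable lborel (\<lambda>x. (exp (- ?Q x / 2) * (1 + (norm x)\<^sup>2)) / sqrt ((2 * pi) ^ CARD('n) * det S))"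
    by (rule integrable_divide)
  then show ?thesis by (simp add: gaussian_density_def)
qed

text \<open>The logarithm of a Gaussian density is a quadratic polynomial. Together with the
  previous lemma this makes every logarithm in the entropies integrable.\<close>

lemma ln_gaussian_density_bound:
  fixes S :: "real^'n^'n"
  assumes S: "pos_def_matrix S"
  obtains C where "0 \<le> C" "\<And>x. \<bar>ln (gaussian_density m S x)\<bar> \<le> C * (1 + (norm x)\<^sup>2)"
proof -
  let ?P = "matrix_inv S"
  let ?c = "sqrt ((2 * pi) ^ CARD('n) * det S)"
  have c: "0 < ?c" using pos_def_matrix_det_pos[OF S] by simp
  obtain k where k: "0 < k" "\<And>x. norm (?P *v x) \<le> norm x * k"
    using bounded_linear.pos_bounded[OF matrix_vector_mul_bounded_linear[of ?P]] by blast
  have "\<bar>ln (gaussian_density m S x)\<bar> \<le> (\<bar>ln ?c\<bar> + k + k * (norm m)\<^sup>2) * (1 + (norm x)\<^sup>2)" for x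
  proof -
    let ?Q = "(x - m) \<bullet> (?P *v (x - m))"
    have "\<bar>?Q\<bar> \<le> norm (x - m) * (norm (x - m) * k)"
      using Cauchy_Schwarz_ineq2[of "x - m" "?P *v (x - m)"] k(2)[of "x - m"]
      by (meson mult_left_mono norm_ge_zero order_trans)
    also have "\<dots> = k * (norm (x - m))\<^sup>2" by (simp add: power2_eq_square)
    also have "\<dots> \<le> k * (norm x + norm m)\<^sup>2"
      using k(1) by (intro mult_left_mono power_mono norm_triangle_ineq4) auto
    also have "\<dots> \<le> k * (2 * (norm x)\<^sup>2 + 2 * (norm m)\<^sup>2)"
      using k(1) sum_squares_bound[of "norm x" "norm m"] by (intro mult_left_mono) (auto simp: power2_sum)
    finally have Q: "\<bar>?Q / 2\<bar> \<le> k * (norm x)\<^sup>2 + k * (norm m)\<^sup>2" by (simp add: algebra_simps)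
    have "ln (gaussian_density m S x) = - ?Q / 2 - ln ?c"
      unfolding gaussian_density_def using c by (subst ln_div) auto
    then have "\<bar>ln (gaussian_density m S x)\<bar> \<le> \<bar>?Q / 2\<bar> + \<bar>ln ?c\<bar>" by linarith
    also have "\<dots> \<le> k * (norm x)\<^sup>2 + k * (norm m)\<^sup>2 + \<bar>ln ?c\<bar>" using Q by simp
    also have "\<dots> \<le> (\<bar>ln ?c\<bar> + k + k * (norm m)\<^sup>2) * (1 + (norm x)\<^sup>2)"
    proof -
      have "0 \<le> \<bar>ln ?c\<bar> * (norm x)\<^sup>2" "0 \<le> k * (norm m)\<^sup>2 * (norm x)\<^sup>2" using k(1) by simp_all
      then show ?thesis using k(1) by (simp add: algebra_simps)
    qed
    finally show ?thesis .
  qed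
  moreover have "0 \<le> \<bar>ln ?c\<bar> + k + k * (norm m)\<^sup>2" using k(1) by simp
  ultimately show thesis using that by blast
qed

text \<open>The mean is the only maximum point of the density. Once the means agree, the maximal
  values give equal normalizing constants, then equal quadratic forms, and polarization recovers the
  matrices.\<close>

lemma gaussian_density_inject:
  assumes S: "pos_def_matrix S" and T: "pos_def_matrix T"
    and eq: "\<And>x. gaussian_density m S x = gaussian_density n T x"
  shows "m = n" "S = T"
proof -
  have Si: "pos_def_matrix (matrix_inv S)" and Ti: "pos_def_matrix (matrix_inv T)"
    by (rule pos_def_matrix_inverse[OF S], rule pos_def_matrix_inverse[OF T])
  let ?c = "sqrt ((2 * pi) ^ CARD('a) * det S)" and ?d = "sqrt ((2 * pi) ^ CARD('a) * det T)"
  have c: "0 < ?c" "0 < ?d" using pos_def_matrix_det_pos[OF S] pos_def_matrix_det_pos[OF T] by simp_all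
  \<comment> \<open>Both sides are maximal values: the maximum of the second density is attained at
    \<open>n\<close>, where the first density takes the same value.\<close>
  have le: "1 / ?d \<le> 1 / ?c"
  proof -
    have "1 / ?d = gaussian_density n T n" by (simp add: gaussian_density_def)
    also have "\<dots> = gaussian_density m S n" by (simp add: eq)
    also have "\<dots> \<le> 1 / ?c"
      unfolding gaussian_density_def using c pos_def_matrix_inner_nonneg[OF Si]
      by (intro divide_right_mono) auto
    finally show ?thesis .
  qed
  show mn: "m = n"
  proof (rule ccontr)
    assume "m \<noteq> n"
    then have "exp (- ((m - n) \<bullet> (matrix_inv T *v (m - n))) / 2) < 1"
      using pos_def_matrix_inner_pos[OF Ti, of "m - n"] by simp
    then have "gaussian_density n T m < 1 / ?d"
      unfolding gaussian_density_def using c by (intro divide_strict_right_mono) auto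
    moreover have "gaussian_density n T m = 1 / ?c"
      using eq[of m] by (simp add: gaussian_density_def)
    ultimately show False using le by simp
  qed
  have cd: "?c = ?d" using eq[of m] c by (simp add: mn gaussian_density_def)
  have q: "x \<bullet> (matrix_inv S *v x) = x \<bullet> (matrix_inv T *v x)" for x
  proof -
    define d where "d = ?d"
    have "exp (- (x \<bullet> (matrix_inv S *v x)) / 2) / d = exp (- (x \<bullet> (matrix_inv T *v x)) / 2) / d"
      using eq[of "x + n"] by (simp only: gaussian_density_def mn cd add_diff_cancel_right' d_def)
    moreover have "d \<noteq> 0" using c(2) by (simp only: d_def)
    ultimately show ?thesis by simp
  qed
  \<comment> \<open>Polarization: the forms agree at \<open>x\<close>, \<open>y\<close> and
    \<open>x + y\<close>, and both are symmetric.\<close>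
  have "y \<bullet> (matrix_inv S *v x) = y \<bullet> (matrix_inv T *v x)" for x y
    using q[of "x + y"] q[of x] q[of y]
      pos_def_matrix_symmetric_inner[OF Si, of x y] pos_def_matrix_symmetric_inner[OF Ti, of x y]
    by (simp add: matrix_vector_right_distrib inner_add_left inner_add_right)
  then have "matrix_inv S *v x = matrix_inv T *v x" for x using vector_eq_ldot[THEN iffD1] by blast
  then have inv: "matrix_inv S *v x = matrix_inv T *v x" for x .
  have "S *v x = T *v x" for x
  proof -
    have "matrix_inv T *v (T *v x) = x"
      using T by (simp add: matrix_vector_mul_assoc matrix_inv_left pos_def_matrix_invertible)
    then have "matrix_inv S *v (T *v x) = x" by (simp add: inv)
    then have "S *v x = S *v (matrix_inv S *v (T *v x))" by simp
    then show ?thesis by (simp add: pos_def_matrix_inverse(3)[OF S])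
  qed
  then show "S = T" by (simp add: matrix_eq)
qed

section \<open>Conditioning Gaussian densities\<close>

lemma block_vector_inner [simp]:
  "block_vector x y \<bullet> block_vector x' y' = x \<bullet> x' + y \<bullet> y'"
  by (simp add: inner_vec_def block_vector_def UNIV_Plus_UNIV[symmetric] Plus_def
      sum.union_disjoint sum.reindex del: UNIV_Plus_UNIV)
    (subst sum.union_disjoint; auto simp: sum.reindex)

lemma block_vector_diff: "block_vector x y - block_vector x' y' = block_vector (x - x') (y - y')"
  by (auto simp: block_vector_def vec_eq_iff split: sum.split)

lemma block_vector_exhaust: obtains x y where "z = block_vector x y"
proof
  show "z = block_vector (\<chi> i. z $ Inl i) (\<chi> j. z $ Inr j)"
    by (auto simp: block_vector_def vec_eq_iff split: sum.split)
qed

lemma norm_block_vector: "(norm (block_vector x y))\<^sup>2 = (norm x)\<^sup>2 + (norm y)\<^sup>2"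
  by (simp add: power2_norm_eq_inner)

lemma block_vector_eq_0_iff: "block_vector x y = 0 \<longleftrightarrow> x = 0 \<and> y = 0"
  by (auto simp: block_vector_def vec_eq_iff split: sum.split)

lemma block_matrix_mult:
  fixes A :: "real^'p^'p" and B :: "real^'q^'p" and C :: "real^'q^'q"
  shows "block_matrix A B C *v block_vector u v =
    block_vector (A *v u + B *v v) (transpose B *v u + C *v v)"
proof -
  have "(block_matrix A B C *v block_vector u v) $ i =
      block_vector (A *v u + B *v v) (transpose B *v u + C *v v) $ i" for i
  proof -
    have "(block_matrix A B C *v block_vector u v) $ i = block_matrix A B C $ i \<bullet> block_vector u v"
      by (rule matrix_vector_mul_component)
    also have "\<dots> = block_vector (A *v u + B *v v) (transpose B *v u + C *v v) $ i"
      by (cases i) (simp_all add: block_matrix_def del: transpose_matrix_vector, simp_all add: block_vector_def matrix_vector_mul_component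
          del: transpose_matrix_vector)
    finally show ?thesis .
  qed
  then show ?thesis by (simp add: vec_eq_iff)
qed

text \<open>Block elimination. Testing the form on \<open>block_vector x 0\<close> shows that the
  upper block is positive definite. The inverse is evaluated by solving for a preimage of
  \<open>block_vector x y\<close>, and the quadratic form then appears with the square in
  \<open>y\<close> completed.\<close>

lemma
  fixes A :: "real^'p^'p" and B :: "real^'q^'p" and C :: "real^'q^'q"
  assumes pd: "pos_def_matrix (block_matrix A B C)"
  defines "R \<equiv> transpose B ** matrix_inv A" and "S \<equiv> C - transpose B ** matrix_inv A ** B"
  shows pos_def_block_upper: "pos_def_matrix A"
    and pos_def_schur_complement: "pos_def_matrix S"
    and block_quadratic_form: "block_vector x y \<bullet> (matrix_inv (block_matrix A B C) *v block_vector x y) =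
      x \<bullet> (matrix_inv A *v x) + (y - R *v x) \<bullet> (matrix_inv S *v (y - R *v x))"
proof -
  let ?M = "block_matrix A B C"
  have entry: "?M $ i $ j = ?M $ j $ i" for i j
  proof -
    have "transpose ?M $ i $ j = ?M $ i $ j" using pd by (simp add: pos_def_matrix_def)
    then show ?thesis by (simp add: transpose_def)
  qed
  have tA: "transpose A = A"
  proof -
    have "A $ i $ j = A $ j $ i" for i j
      using entry[of "Inl i" "Inl j"] by (simp add: block_matrix_def block_vector_def)
    then show ?thesis by (simp add: vec_eq_iff transpose_def)
  qed
  have tC: "transpose C = C"
  proof -
    have "C $ i $ j = C $ j $ i" for i j
      using entry[of "Inr i" "Inr j"] by (simp add: block_matrix_def block_vector_def)
    then show ?thesis by (simp add: vec_eq_iff transpose_def)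
  qed
  show A: "pos_def_matrix A"
    unfolding pos_def_matrix_def
  proof (intro conjI allI impI tA)
    fix x :: "real^'p" assume "x \<noteq> 0"
    then have "0 < block_vector x 0 \<bullet> (?M *v block_vector x 0)"
      by (intro pos_def_matrix_inner_pos[OF pd]) (simp add: block_vector_eq_0_iff)
    then show "0 < x \<bullet> (A *v x)" by (simp add: block_matrix_mult)
  qed
  have Ai: "pos_def_matrix (matrix_inv A)" and AAi: "A *v (matrix_inv A *v x) = x" for x
    using pos_def_matrix_inverse[OF A] by auto
  have Sv: "S *v v = C *v v - transpose B *v (matrix_inv A *v (B *v v))" for v
    by (simp add: S_def matrix_vector_mult_diff_rdistrib matrix_vector_mul_assoc matrix_mul_assoc
        del: transpose_matrix_vector)
  show S: "pos_def_matrix S"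
    unfolding pos_def_matrix_def
  proof (intro conjI allI impI)
    have "transpose (matrix_inv A) = matrix_inv A" using Ai by (simp add: pos_def_matrix_def)
    then have "transpose (transpose B ** matrix_inv A ** B) = transpose B ** matrix_inv A ** B"
      by (simp add: matrix_transpose_mul matrix_mul_assoc)
    then show "transpose S = S" using tC by (simp add: S_def transpose_def vec_eq_iff)
    fix v :: "real^'q" assume v: "v \<noteq> 0"
    \<comment> \<open>The first block is chosen so that the first block of \<open>?M *v ?z\<close>
      vanishes and the second is \<open>S *v v\<close>.\<close>
    let ?z = "block_vector (- (matrix_inv A *v (B *v v))) v"
    have "?M *v ?z = block_vector 0 (S *v v)"
      by (simp add: block_matrix_mult Sv linear_neg[OF matrix_vector_mul_linear] AAi
          del: transpose_matrix_vector)
    moreover have "0 < ?z \<bullet> (?M *v ?z)"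
      using v by (intro pos_def_matrix_inner_pos[OF pd]) (simp add: block_vector_eq_0_iff)
    ultimately show "0 < v \<bullet> (S *v v)" by simp
  qed
  let ?w = "y - R *v x"
  \<comment> \<open>Eliminating the first unknown leaves \<open>S *v v = y - R *v x\<close>; back
    substitution gives \<open>u\<close>.\<close>
  define v where "v = matrix_inv S *v ?w"
  define u where "u = matrix_inv A *v (x - B *v v)"
  have u: "u = matrix_inv A *v x - matrix_inv A *v (B *v v)"
    by (simp add: u_def matrix_vector_mult_diff_distrib)
  have Rx: "R *v x = transpose B *v (matrix_inv A *v x)"
    by (simp add: R_def matrix_vector_mul_assoc del: transpose_matrix_vector)
  have "?M *v block_vector u v = block_vector x y"
  proof -
    have "A *v u + B *v v = x" by (simp add: u_def AAi)
    moreover have "transpose B *v u + C *v v = R *v x + S *v v"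
      by (simp add: u Sv Rx matrix_vector_mult_diff_distrib del: transpose_matrix_vector)
    moreover have "S *v v = ?w" by (simp add: v_def pos_def_matrix_inverse(3)[OF S])
    ultimately show ?thesis by (simp add: block_matrix_mult)
  qed
  then have "matrix_inv ?M *v (?M *v block_vector u v) = matrix_inv ?M *v block_vector x y" by simp
  then have inv: "matrix_inv ?M *v block_vector x y = block_vector u v"
    by (simp add: matrix_vector_mul_assoc matrix_inv_left pos_def_matrix_invertible[OF pd])
  have "x \<bullet> (matrix_inv A *v (B *v v)) = (B *v v) \<bullet> (matrix_inv A *v x)"
    by (rule pos_def_matrix_symmetric_inner[OF Ai])
  also have "\<dots> = v \<bullet> (R *v x)" by (simp only: Rx inner_transpose_mult)
  finally have xB: "x \<bullet> (matrix_inv A *v (B *v v)) = v \<bullet> (R *v x)" .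
  have "block_vector x y \<bullet> (matrix_inv ?M *v block_vector x y) = x \<bullet> u + y \<bullet> v" by (simp add: inv)
  also have "\<dots> = x \<bullet> (matrix_inv A *v x) + ?w \<bullet> v"
    by (simp add: u xB inner_diff_right inner_diff_left inner_commute)
  finally show "block_vector x y \<bullet> (matrix_inv ?M *v block_vector x y) =
      x \<bullet> (matrix_inv A *v x) + ?w \<bullet> (matrix_inv S *v ?w)" by (simp only: v_def)
qed

section \<open>Factoring a joint density into marginal and conditional densities\<close>

lemma linear_block_vector: "linear (\<lambda>(x, y). block_vector x y)"
  by (auto simp: linear_iff block_vector_def vec_eq_iff split: sum.split)

lemma block_vector_measurable [measurable]:
  "(\<lambda>(x, y). block_vector x y) \<in> borel \<Otimes>\<^sub>M borel \<rightarrow>\<^sub>M borel"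
  unfolding borel_prod by (rule borel_measurable_linear[OF linear_block_vector])

lemma Basis_real_vec_eq: "(Basis :: (real^'n) set) = range (\<lambda>i. axis i 1)"
  by (auto simp: Basis_vec_def)

lemma lborel_distr_block_vector:
  "distr (lborel \<Otimes>\<^sub>M lborel) borel (\<lambda>(x :: real^'p::finite, y :: real^'q::finite). block_vector x y) = lborel"
  unfolding lborel_prod
proof (rule lborel_distr_basis_bij[OF linear_block_vector])
  let ?b = "\<lambda>(x :: real^'p::finite, y :: real^'q::finite). block_vector x y"
  have ax: "block_vector (axis i 1 :: real^'p) (0 :: real^'q) = axis (Inl i) 1"
    "block_vector (0 :: real^'p) (axis j 1 :: real^'q) = axis (Inr j) 1" for i j
    by (auto simp: block_vector_def vec_eq_iff axis_def split: sum.split)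
  show "bij_betw ?b Basis Basis"
    unfolding bij_betw_def
  proof
    show "inj_on ?b Basis"
      by (rule inj_onI) (auto simp: block_vector_def vec_eq_iff split: sum.splits)
    have "(Basis :: (real^('p + 'q)) set) = range (\<lambda>i. axis i 1)" by (rule Basis_real_vec_eq)
    also have "\<dots> = range (\<lambda>i. axis (Inl i) 1) \<union> range (\<lambda>j. axis (Inr j) 1)"
      by (auto simp: image_iff) (metis sum.exhaust)
    also have "\<dots> = ?b ` Basis"
      by (simp add: Basis_prod_def Basis_real_vec_eq image_Un image_image ax)
    finally show "?b ` Basis = Basis" ..
  qed
qed

text \<open>The constant relating both sides is \<open>1\<close> because both are probability densities.\<close>

lemma gaussian_density_block:
  fixes A :: "real^'p^'p" and B :: "real^'q^'p" and C :: "real^'q^'q"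
  assumes pd: "pos_def_matrix (block_matrix A B C)"
  defines "R \<equiv> transpose B ** matrix_inv A" and "S \<equiv> C - transpose B ** matrix_inv A ** B"
  shows "gaussian_density (block_vector m n) (block_matrix A B C) (block_vector x y) =
    gaussian_density m A x * gaussian_density (n + R *v (x - m)) S y"
proof -
  note A = pos_def_block_upper[OF pd] and S = pos_def_schur_complement[OF pd, folded S_def]
  let ?cM = "sqrt ((2 * pi) ^ CARD('p + 'q) * det (block_matrix A B C))"
  let ?cA = "sqrt ((2 * pi) ^ CARD('p) * det A)" and ?cS = "sqrt ((2 * pi) ^ CARD('q) * det S)"
  have pos: "0 < ?cM" "0 < ?cA" "0 < ?cS"
    using pos_def_matrix_det_pos[OF A] pos_def_matrix_det_pos[OF S] pos_def_matrix_det_pos[OF pd]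
    by simp_all
  define r where "r = ?cA * ?cS / ?cM"
  have r: "0 \<le> r" using pos by (simp add: r_def)
  have prod: "gaussian_density (block_vector m n) (block_matrix A B C) (block_vector x y) =
    r * (gaussian_density m A x * gaussian_density (n + R *v (x - m)) S y)" for x y
  proof -
    define qA where "qA = (x - m) \<bullet> (matrix_inv A *v (x - m))"
    define qS where "qS = (y - (n + R *v (x - m))) \<bullet> (matrix_inv S *v (y - (n + R *v (x - m))))"
    have "(block_vector x y - block_vector m n) \<bullet>
        (matrix_inv (block_matrix A B C) *v (block_vector x y - block_vector m n)) = qA + qS"
      unfolding block_vector_diff block_quadratic_form[OF pd] qA_def qS_def R_def S_def diff_diff_eq ..
    then have "gaussian_density (block_vector m n) (block_matrix A B C) (block_vector x y) =
        exp (- (qA + qS) / 2) / ?cM" by (simp only: gaussian_density_def)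
    also have "exp (- (qA + qS) / 2) = exp (- qA / 2) * exp (- qS / 2)"
      by (simp add: add_divide_distrib diff_divide_distrib flip: exp_add)
    also have "exp (- qA / 2) * exp (- qS / 2) / ?cM = r * ((exp (- qA / 2) / ?cA) * (exp (- qS / 2) / ?cS))"
    proof -
      have "a * b / e = (c * d / e) * ((a / c) * (b / d))" if "0 < e" "0 < c" "0 < d" for a b c d e :: real
        using that by (simp add: field_simps)
      from this[OF pos] show ?thesis unfolding r_def .
    qed
    finally show ?thesis by (simp only: gaussian_density_def qA_def qS_def)
  qed
  have [measurable]: "(\<lambda>(x, y). gaussian_density (n + R *v (x - m)) S y) \<in> borel_measurable (borel \<Otimes>\<^sub>M borel)"
  proof -
    have "(\<lambda>(x, y). gaussian_density (n + R *v (x - m)) S y) = (\<lambda>(x, y). gaussian_density 0 S (y - (n + R *v (x - m))))"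
      by (simp add: gaussian_density_def)
    then show ?thesis by simp
  qed
  \<comment> \<open>For every \<open>x\<close> the inner integral over \<open>y\<close> removes the
    conditional factor, wherever its mean lies; the outer integral then removes the marginal factor
    and leaves \<open>r\<close>.\<close>
  have "1 = (\<integral>\<^sup>+z. ennreal (gaussian_density (block_vector m n) (block_matrix A B C) z) \<partial>lborel)"
    by (rule nn_integral_gaussian_density[OF pd, symmetric])
  also have "\<dots> = (\<integral>\<^sup>+(x, y). ennreal (gaussian_density (block_vector m n) (block_matrix A B C) (block_vector x y))
      \<partial>(lborel \<Otimes>\<^sub>M lborel))"
    by (subst lborel_distr_block_vector[symmetric], subst nn_integral_distr) (auto simp: split_beta')
  also have "\<dots> = (\<integral>\<^sup>+x. \<integral>\<^sup>+y. ennreal (r * (gaussian_density m A x * gaussian_density (n + R *v (x - m)) S y))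
      \<partial>lborel \<partial>lborel)"
    by (subst lborel.nn_integral_fst[symmetric]) (simp_all add: prod)
  also have "\<dots> = (\<integral>\<^sup>+x. ennreal r * ennreal (gaussian_density m A x) \<partial>lborel)"
  proof (rule nn_integral_cong)
    fix x
    have "0 \<le> gaussian_density m A x" using gaussian_density_pos[OF A] less_imp_le by blast
    then have "(\<integral>\<^sup>+y. ennreal (r * (gaussian_density m A x * gaussian_density (n + R *v (x - m)) S y)) \<partial>lborel) =
        (\<integral>\<^sup>+y. (ennreal r * ennreal (gaussian_density m A x)) * ennreal (gaussian_density (n + R *v (x - m)) S y) \<partial>lborel)"
      using r by (intro nn_integral_cong) (simp add: ennreal_mult' mult.assoc)
    also have "\<dots> = ennreal r * ennreal (gaussian_density m A x)"
      by (subst nn_integral_cmult) (simp_all add: nn_integral_gaussian_density[OF S])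
    finally show "(\<integral>\<^sup>+y. ennreal (r * (gaussian_density m A x * gaussian_density (n + R *v (x - m)) S y)) \<partial>lborel) =
        ennreal r * ennreal (gaussian_density m A x)" .
  qed
  also have "\<dots> = ennreal r"
    by (subst nn_integral_cmult) (simp_all add: nn_integral_gaussian_density[OF A])
  finally have "r = 1" using r by (simp add: ennreal_1[symmetric] del: ennreal_1)
  then show ?thesis using prod by simp
qed

section \<open>Relative entropy\<close>

lemma log_exp_one: "log (exp 1) x = ln x"
  by (simp add: log_def)

text \<open>Composing the density with the left inverse \<open>T'\<close> gives the density of the
  pushforwards, so both divergences are integrals of the same function.\<close>

lemma KL_divergence_distr:
  assumes "1 < b" "sigma_finite_measure M" "sigma_finite_measure (distr M R T)"
    and T[measurable]: "T \<in> M \<rightarrow>\<^sub>M R" and T'[measurable]: "T' \<in> R \<rightarrow>\<^sub>M M"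
    and inv: "\<And>x. x \<in> space M \<Longrightarrow> T' (T x) = x"
    and r[measurable]: "r \<in> borel_measurable M" and nonneg: "\<And>x. 0 \<le> r x"
  shows "KL_divergence b (distr M R T) (distr (density M (\<lambda>x. ennreal (r x))) R T) =
    KL_divergence b M (density M (\<lambda>x. ennreal (r x)))"
proof -
  \<comment> \<open>Inserting \<open>T' (T x)\<close> makes the density a function of
    \<open>T x\<close>, the form in which it can be moved to \<open>R\<close>.\<close>
  have "distr (density M (\<lambda>x. ennreal (r x))) R T =
      distr (density M (\<lambda>x. ennreal (r (T' (T x))))) R T"
    using inv by (intro distr_cong density_cong AE_I2) (auto simp: inv)
  also have "\<dots> = density (distr M R T) (\<lambda>y. ennreal (r (T' y)))"
    by (rule density_distr[symmetric]) measurable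
  finally have "KL_divergence b (distr M R T) (distr (density M (\<lambda>x. ennreal (r x))) R T) =
      (\<integral>y. r (T' y) * log b (r (T' y)) \<partial>distr M R T)"
    using sigma_finite_measure.KL_density[OF assms(3,1), of "\<lambda>y. r (T' y)"] nonneg by simp
  also have "\<dots> = (\<integral>x. r (T' (T x)) * log b (r (T' (T x))) \<partial>M)"
    by (rule integral_distr) measurable
  also have "\<dots> = (\<integral>x. r x * log b (r x) \<partial>M)"
    by (rule Bochner_Integration.integral_cong) (auto simp: inv)
  also have "\<dots> = KL_divergence b M (density M (\<lambda>x. ennreal (r x)))"
    using sigma_finite_measure.KL_density[OF assms(2,1) r] nonneg by simp
  finally show ?thesis .
qed

text \<open>Evaluates a divergence in coordinates when the target space carries no convenient
  reference measure: the second measure itself serves as the reference.\<close>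

lemma relative_entropy_distr_density:
  fixes p q :: "'a \<Rightarrow> real"
  assumes M: "sigma_finite_measure M"
    and T[measurable]: "T \<in> M \<rightarrow>\<^sub>M R" and T'[measurable]: "T' \<in> R \<rightarrow>\<^sub>M M"
    and inv: "\<And>x. x \<in> space M \<Longrightarrow> T' (T x) = x"
    and p[measurable]: "p \<in> borel_measurable M" and q[measurable]: "q \<in> borel_measurable M"
    and pos: "\<And>x. 0 < p x" "\<And>x. 0 < q x"
    and q1: "(\<integral>\<^sup>+x. ennreal (q x) \<partial>M) = 1"
  shows "relative_entropy (distr (density M (\<lambda>x. ennreal (p x))) R T)
      (distr (density M (\<lambda>x. ennreal (q x))) R T) = (\<integral>x. p x * ln (p x / q x) \<partial>M)"
proof -
  let ?Q = "density M (\<lambda>x. ennreal (q x))"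
  interpret M: sigma_finite_measure M by (rule M)
  interpret Q: prob_space ?Q
    by (rule prob_spaceI) (simp add: emeasure_density q1 cong: nn_integral_cong)
  have TQ: "T \<in> ?Q \<rightarrow>\<^sub>M R" and TQ': "T' \<in> R \<rightarrow>\<^sub>M ?Q" by simp_all
  interpret D: prob_space "distr ?Q R T" by (rule Q.prob_space_distr[OF TQ])
  have nn: "0 \<le> p x / q x" for x using pos[of x] by simp
  \<comment> \<open>Since \<open>q\<close> is positive, \<open>p / q\<close> is the density of the
    first measure with respect to the second.\<close>
  have dens: "density ?Q (\<lambda>x. ennreal (p x / q x)) = density M (\<lambda>x. ennreal (p x))"
    using pos by (intro density_density_divide) (auto intro: less_imp_le simp: less_imp_neq[symmetric])
  have "relative_entropy (distr (density M (\<lambda>x. ennreal (p x))) R T) (distr ?Q R T) =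
      KL_divergence (exp 1) ?Q (density ?Q (\<lambda>x. ennreal (p x / q x)))"
    unfolding relative_entropy_def dens[symmetric]
    by (rule KL_divergence_distr[OF _ Q.sigma_finite_measure_axioms D.sigma_finite_measure_axioms TQ TQ'])
      (use inv nn in auto)
  also have "\<dots> = (\<integral>x. p x * log (exp 1) (p x / q x) \<partial>M)"
    unfolding dens using pos
    by (intro M.KL_density_density) (auto intro: less_imp_le simp: less_imp_neq[symmetric])
  finally show ?thesis by (simp only: log_exp_one)
qed

text \<open>The difference of the two divergences is the integral of
  \<open>f\<^sub>1 f\<^sub>2 (g\<^sub>2 / f\<^sub>2 - 1 - ln (g\<^sub>2 / f\<^sub>2))\<close>, whose integrand is nonnegative and vanishes only where
  \<open>f\<^sub>2 = g\<^sub>2\<close>.\<close>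

lemma (in pair_sigma_finite) KL_chain_rule_eq_iff:
  fixes f1 g1 :: "'a \<Rightarrow> real" and f2 g2 :: "'a \<Rightarrow> 'b \<Rightarrow> real"
  assumes [measurable]: "f1 \<in> borel_measurable M1" "g1 \<in> borel_measurable M1"
      "(\<lambda>(x, y). f2 x y) \<in> borel_measurable (M1 \<Otimes>\<^sub>M M2)" "(\<lambda>(x, y). g2 x y) \<in> borel_measurable (M1 \<Otimes>\<^sub>M M2)"
    and pos: "\<And>x. 0 < f1 x" "\<And>x. 0 < g1 x" "\<And>x y. 0 < f2 x y" "\<And>x y. 0 < g2 x y"
    and f1: "(\<integral>\<^sup>+x. ennreal (f1 x) \<partial>M1) = 1"
    and f2: "\<And>x. x \<in> space M1 \<Longrightarrow> (\<integral>\<^sup>+y. ennreal (f2 x y) \<partial>M2) = 1"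
    and g2: "\<And>x. x \<in> space M1 \<Longrightarrow> (\<integral>\<^sup>+y. ennreal (g2 x y) \<partial>M2) = 1"
    and int1: "integrable (M1 \<Otimes>\<^sub>M M2) (\<lambda>(x, y). f1 x * f2 x y * ln (f1 x / g1 x))"
    and int2: "integrable (M1 \<Otimes>\<^sub>M M2) (\<lambda>(x, y). f1 x * f2 x y * ln (f2 x y / g2 x y))"
  shows "(\<integral>(x, y). f1 x * f2 x y * ln (f1 x * f2 x y / (g1 x * g2 x y)) \<partial>(M1 \<Otimes>\<^sub>M M2)) =
      (\<integral>x. f1 x * ln (f1 x / g1 x) \<partial>M1) \<longleftrightarrow> (AE (x, y) in M1 \<Otimes>\<^sub>M M2. f2 x y = g2 x y)"
proof -
  let ?P = "M1 \<Otimes>\<^sub>M M2"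
  \<comment> \<open>Applied to both conditional families: \<open>f1 * f2\<close> and
    \<open>f1 * g2\<close> are probability densities on the product.\<close>
  have mass: "(\<integral>\<^sup>+z. ennreal (f1 (fst z) * k (fst z) (snd z)) \<partial>?P) = 1"
    if [measurable]: "(\<lambda>(x, y). k x y) \<in> borel_measurable ?P"
      and k: "\<And>x. x \<in> space M1 \<Longrightarrow> (\<integral>\<^sup>+y. ennreal (k x y) \<partial>M2) = 1" for k
  proof -
    have "(\<integral>\<^sup>+z. ennreal (f1 (fst z) * k (fst z) (snd z)) \<partial>?P) =
        (\<integral>\<^sup>+x. \<integral>\<^sup>+y. ennreal (f1 x * k x y) \<partial>M2 \<partial>M1)"
      by (subst M2.nn_integral_fst[symmetric]) simp_all
    also have "\<dots> = (\<integral>\<^sup>+x. ennreal (f1 x) \<partial>M1)"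
    proof (rule nn_integral_cong)
      fix x assume x: "x \<in> space M1"
      have "(\<integral>\<^sup>+y. ennreal (f1 x * k x y) \<partial>M2) = (\<integral>\<^sup>+y. ennreal (f1 x) * ennreal (k x y) \<partial>M2)"
        using pos(1)[of x] by (simp add: ennreal_mult')
      also have "\<dots> = ennreal (f1 x)"
        using x by (subst nn_integral_cmult) (simp_all add: k)
      finally show "(\<integral>\<^sup>+y. ennreal (f1 x * k x y) \<partial>M2) = ennreal (f1 x)" .
    qed
    finally show ?thesis by (simp add: f1)
  qed
  have int: "integrable ?P (\<lambda>z. f1 (fst z) * k (fst z) (snd z))"
    "(\<integral>z. f1 (fst z) * k (fst z) (snd z) \<partial>?P) = 1"
    if "(\<lambda>(x, y). k x y) \<in> borel_measurable ?P" "\<And>x y. 0 < k x y"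
      "\<And>x. x \<in> space M1 \<Longrightarrow> (\<integral>\<^sup>+y. ennreal (k x y) \<partial>M2) = 1" for k
  proof -
    note [measurable] = that(1)
    have m: "(\<lambda>z. f1 (fst z) * k (fst z) (snd z)) \<in> borel_measurable ?P" by simp
    have nn: "0 \<le> f1 (fst z) * k (fst z) (snd z)" for z
      using pos(1) that(2) by (simp add: less_imp_le)
    show "integrable ?P (\<lambda>z. f1 (fst z) * k (fst z) (snd z))"
      using mass[OF that(1,3)] nn m by (intro integrableI_nonneg) auto
    show "(\<integral>z. f1 (fst z) * k (fst z) (snd z) \<partial>?P) = 1"
      using mass[OF that(1,3)] nn m by (intro integral_eq_nn_integral[THEN trans]) auto
  qed
  note intf = int[OF assms(3) pos(3) f2] and intg = int[OF assms(4) pos(4) g2]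
  let ?L1 = "\<lambda>z. f1 (fst z) * f2 (fst z) (snd z) * ln (f1 (fst z) / g1 (fst z))"
  let ?L2 = "\<lambda>z. f1 (fst z) * f2 (fst z) (snd z) * ln (f2 (fst z) (snd z) / g2 (fst z) (snd z))"
  have i1: "integrable ?P ?L1" and i2: "integrable ?P ?L2"
    using int1 int2 by (simp_all add: split_beta')
  have "(\<integral>z. ?L1 z \<partial>?P) = (\<integral>x. \<integral>y. f1 x * f2 x y * ln (f1 x / g1 x) \<partial>M2 \<partial>M1)"
    using integral_fst'[OF i1] by simp
  also have "\<dots> = (\<integral>x. f1 x * ln (f1 x / g1 x) \<partial>M1)"
  proof (rule Bochner_Integration.integral_cong[OF refl])
    fix x assume x: "x \<in> space M1"
    have "(\<lambda>y. f2 x y) \<in> borel_measurable M2"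
      using measurable_compose_Pair1[OF x assms(3)] by simp
    then have "(\<integral>y. f2 x y \<partial>M2) = 1"
      using f2[OF x] pos(3) by (intro integral_eq_nn_integral[THEN trans]) (auto intro: less_imp_le)
    moreover have "(\<integral>y. f1 x * f2 x y * ln (f1 x / g1 x) \<partial>M2) =
        (\<integral>y. (f1 x * ln (f1 x / g1 x)) * f2 x y \<partial>M2)" by (simp add: mult_ac)
    ultimately show "(\<integral>y. f1 x * f2 x y * ln (f1 x / g1 x) \<partial>M2) = f1 x * ln (f1 x / g1 x)"
      by simp
  qed
  finally have L1: "(\<integral>z. ?L1 z \<partial>?P) = (\<integral>x. f1 x * ln (f1 x / g1 x) \<partial>M1)" .
  let ?\<phi> = "\<lambda>t::real. t - 1 - ln t"
  have \<phi>: "0 \<le> ?\<phi> t" "?\<phi> t = 0 \<longleftrightarrow> t = 1" if "0 < t" for t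
    using ln_le_minus_one[OF that] ln_eq_minus_one[OF that] by auto
  let ?G = "\<lambda>z. f1 (fst z) * f2 (fst z) (snd z) * ?\<phi> (g2 (fst z) (snd z) / f2 (fst z) (snd z))"
  have G: "?G z = f1 (fst z) * g2 (fst z) (snd z) - f1 (fst z) * f2 (fst z) (snd z) + ?L2 z" for z
    using pos(3,4)[of "fst z" "snd z"] by (simp add: ln_div field_simps)
  have iG: "integrable ?P ?G"
    unfolding G by (intro Bochner_Integration.integrable_add Bochner_Integration.integrable_diff intf intg i2)
  have "(\<integral>(x, y). f1 x * f2 x y * ln (f1 x * f2 x y / (g1 x * g2 x y)) \<partial>?P) = (\<integral>z. ?L1 z + ?L2 z \<partial>?P)"
    using pos by (intro Bochner_Integration.integral_cong refl)
      (simp add: split_beta' ln_div ln_mult less_imp_neq[symmetric] algebra_simps)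
  also have "\<dots> = (\<integral>x. f1 x * ln (f1 x / g1 x) \<partial>M1) + (\<integral>z. ?L2 z \<partial>?P)"
    using i1 i2 by (simp add: L1)
  \<comment> \<open>\<open>?G\<close> differs from \<open>?L2\<close> by
    \<open>f1 * g2 - f1 * f2\<close>, which integrates to \<open>1 - 1\<close>.\<close>
  also have "(\<integral>z. ?L2 z \<partial>?P) = (\<integral>z. ?G z \<partial>?P)"
    unfolding G using intf intg i2 by simp
  finally have "(\<integral>(x, y). f1 x * f2 x y * ln (f1 x * f2 x y / (g1 x * g2 x y)) \<partial>?P) =
      (\<integral>x. f1 x * ln (f1 x / g1 x) \<partial>M1) \<longleftrightarrow> (\<integral>z. ?G z \<partial>?P) = 0" by simp
  also have "\<dots> \<longleftrightarrow> (AE z in ?P. ?G z = 0)"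
    using pos(1,3,4) \<phi>(1) by (intro integral_nonneg_eq_0_iff_AE iG AE_I2) (simp add: less_imp_le)
  also have "\<dots> \<longleftrightarrow> (AE (x, y) in ?P. f2 x y = g2 x y)"
  proof -
    have "?G z = 0 \<longleftrightarrow> (case z of (x, y) \<Rightarrow> f2 x y = g2 x y)" for z
      using pos(1)[of "fst z"] pos(3,4)[of "fst z" "snd z"] \<phi>(2)[of "g2 (fst z) (snd z) / f2 (fst z) (snd z)"]
      by (auto simp: split_beta')
    then show ?thesis by simp
  qed
  finally show ?thesis .
qed

text \<open>The points of disagreement form an open null set, and a nonempty open set is not
  null.\<close>

lemma AE_lborel_continuous_eq:
  fixes f g :: "'a::euclidean_space \<Rightarrow> real"
  assumes "AE x in lborel. f x = g x" "continuous_on UNIV f" "continuous_on UNIV g"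
  shows "f x = g x"
proof (rule ccontr)
  assume ne: "f x \<noteq> g x"
  have "open {x. f x \<noteq> g x}" using assms(2,3) by (rule open_Collect_neq)
  moreover have "negligible {x. f x \<noteq> g x}"
  proof -
    have "{x. f x \<noteq> g x} \<in> null_sets lborel"
      using assms(1) \<open>open {x. f x \<noteq> g x}\<close> by (subst AE_iff_null_sets) auto
    then show ?thesis using negligible_iff_null_sets null_sets_completionI by blast
  qed
  ultimately show False using ne open_not_negligible by blast
qed

lemma distr_fst_density:
  assumes M2: "sigma_finite_measure M2"
    and [measurable]: "f1 \<in> borel_measurable M1" "(\<lambda>(x, y). f2 x y) \<in> borel_measurable (M1 \<Otimes>\<^sub>M M2)"
    and f2: "\<And>x. x \<in> space M1 \<Longrightarrow> (\<integral>\<^sup>+y. f2 x y \<partial>M2) = 1"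
  shows "distr (density (M1 \<Otimes>\<^sub>M M2) (\<lambda>(x, y). f1 x * f2 x y)) M1 fst = density M1 f1"
proof (rule measure_eqI)
  interpret M2: sigma_finite_measure M2 by (rule M2)
  fix A assume "A \<in> sets (distr (density (M1 \<Otimes>\<^sub>M M2) (\<lambda>(x, y). f1 x * f2 x y)) M1 fst)"
  then have A[measurable]: "A \<in> sets M1" by simp
  have "emeasure (distr (density (M1 \<Otimes>\<^sub>M M2) (\<lambda>(x, y). f1 x * f2 x y)) M1 fst) A =
      (\<integral>\<^sup>+z. f1 (fst z) * f2 (fst z) (snd z) * indicator A (fst z) \<partial>(M1 \<Otimes>\<^sub>M M2))"
    by (subst emeasure_distr, simp, simp, subst emeasure_density)
      (auto intro!: nn_integral_cong simp: split_beta' indicator_def space_pair_measure)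
  also have "\<dots> = (\<integral>\<^sup>+x. \<integral>\<^sup>+y. (f1 x * indicator A x) * f2 x y \<partial>M2 \<partial>M1)"
    by (subst M2.nn_integral_fst[symmetric]) (simp_all add: mult_ac)
  also have "\<dots> = (\<integral>\<^sup>+x. f1 x * indicator A x \<partial>M1)"
    by (intro nn_integral_cong) (simp add: nn_integral_cmult f2)
  also have "\<dots> = emeasure (density M1 f1) A" by (simp add: emeasure_density)
  finally show "emeasure (distr (density (M1 \<Otimes>\<^sub>M M2) (\<lambda>(x, y). f1 x * f2 x y)) M1 fst) A =
      emeasure (density M1 f1) A" .
qed simp

section \<open>The entropy gap between block Gaussians and their marginals\<close>

text \<open>Trading the moving mean for a shift of the argument exhibits the conditional density as
  a fixed density composed with an affine map of the pair, hence jointly measurable and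
  continuous.\<close>

lemma gaussian_density_conditional_eq:
  "gaussian_density (n + R *v (x - m)) S y = gaussian_density 0 S (y - (n + R *v (x - m)))"
  by (simp add: gaussian_density_def)

lemma gaussian_density_conditional_measurable [measurable]:
  "(\<lambda>(x, y). gaussian_density (n + R *v (x - m)) S y) \<in> borel_measurable (borel \<Otimes>\<^sub>M borel)"
  by (simp add: gaussian_density_conditional_eq)

lemma continuous_on_gaussian_density: "continuous_on UNIV (gaussian_density m S)"
  unfolding gaussian_density_def[abs_def] divide_inverse
  by (intro continuous_intros linear_continuous_on_compose[OF _ matrix_vector_mul_linear])

lemma continuous_on_gaussian_density_conditional:
  "continuous_on UNIV (\<lambda>z. gaussian_density (n + R *v (fst z - m)) S (snd z))"
  unfolding gaussian_density_conditional_eq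
  by (rule continuous_on_compose2[OF continuous_on_gaussian_density])
    (auto intro!: continuous_intros linear_continuous_on_compose[OF _ matrix_vector_mul_linear])

text \<open>Supplies both integrability conditions of the chain rule, with \<open>q\<close> a
  marginal or a conditional log ratio.\<close>

lemma gaussian_density_pair_integrable:
  fixes S :: "real^('p::finite + 'q::finite)^('p + 'q)"
  assumes S: "pos_def_matrix S"
    and q[measurable]: "(\<lambda>(x, y). q x y) \<in> borel_measurable (borel \<Otimes>\<^sub>M borel)"
    and bound: "\<And>x y. \<bar>q x y\<bar> \<le> C * (1 + (norm (block_vector x y :: real^('p + 'q)))\<^sup>2)"
  shows "integrable (lborel \<Otimes>\<^sub>M lborel) (\<lambda>(x, y). gaussian_density m S (block_vector x y) * q x y)"
proof (rule Bochner_Integration.integrable_bound)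
  let ?b = "\<lambda>(x :: real^'p, y :: real^'q). block_vector x y"
  let ?h = "\<lambda>z. gaussian_density m S z * (1 + (norm z)\<^sup>2)"
  have "integrable (distr (lborel \<Otimes>\<^sub>M lborel) borel ?b) ?h"
    unfolding lborel_distr_block_vector by (rule gaussian_density_quadratic_integrable[OF S])
  then have "integrable (lborel \<Otimes>\<^sub>M lborel) (\<lambda>z. ?h (?b z))"
    by (subst (asm) integrable_distr_eq) auto
  then show "integrable (lborel \<Otimes>\<^sub>M lborel) (\<lambda>z. C * ?h (?b z))" by (rule integrable_mult_right)
  have C: "\<bar>q x y\<bar> \<le> \<bar>C\<bar> * (1 + (norm (block_vector x y :: real^('p + 'q)))\<^sup>2)" for x y
    by (rule order_trans[OF bound]) (simp add: mult_right_mono)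
  show "AE z in lborel \<Otimes>\<^sub>M lborel. norm (case z of (x, y) \<Rightarrow> gaussian_density m S (block_vector x y) * q x y)
      \<le> norm (C * ?h (?b z))"
  proof (rule AE_I2)
    fix z :: "(real^'p) \<times> (real^'q)"
    obtain x y where z: "z = (x, y)" by (cases z)
    let ?d = "gaussian_density m S (block_vector x y)"
    have d: "0 \<le> ?d" using gaussian_density_pos[OF S] by (simp add: less_imp_le)
    have "norm (?d * q x y) = ?d * \<bar>q x y\<bar>" using d by (simp add: abs_mult)
    also have "\<dots> \<le> ?d * (\<bar>C\<bar> * (1 + (norm (block_vector x y :: real^('p + 'q)))\<^sup>2))"
      by (rule mult_left_mono[OF C d])
    also have "\<dots> = norm (C * ?h (?b (x, y)))" using d by (simp add: abs_mult)
    finally show "norm (case z of (x, y) \<Rightarrow> gaussian_density m S (block_vector x y) * q x y)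
        \<le> norm (C * ?h (?b z))"
      unfolding z prod.case .
  qed
qed simp

lemma gaussian_entropy_eq_marginal_entropy_iff:
  fixes A A' :: "real^'p::finite^'p" and B B' :: "real^'q::finite^'p" and C C' :: "real^'q^'q"
    and m m' :: "real^'p" and n n' :: "real^'q"
  assumes pd: "pos_def_matrix (block_matrix A B C)" and pd': "pos_def_matrix (block_matrix A' B' C')"
  defines "R \<equiv> transpose B ** matrix_inv A" and "S \<equiv> C - transpose B ** matrix_inv A ** B"
    and "R' \<equiv> transpose B' ** matrix_inv A'" and "S' \<equiv> C' - transpose B' ** matrix_inv A' ** B'"
    and "F \<equiv> \<lambda>x y. gaussian_density (block_vector m n) (block_matrix A B C) (block_vector x y)"
    and "G \<equiv> \<lambda>x y. gaussian_density (block_vector m' n') (block_matrix A' B' C') (block_vector x y)"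
  shows "(\<integral>(x, y). F x y * ln (F x y / G x y) \<partial>(lborel \<Otimes>\<^sub>M lborel)) =
      (\<integral>x. gaussian_density m A x * ln (gaussian_density m A x / gaussian_density m' A' x) \<partial>lborel) \<longleftrightarrow>
    S = S' \<and> R = R' \<and> n - n' = R' *v (m - m')"
proof -
  note A = pos_def_block_upper[OF pd] and S = pos_def_schur_complement[OF pd, folded S_def]
  note A' = pos_def_block_upper[OF pd'] and S' = pos_def_schur_complement[OF pd', folded S'_def]
  let ?f1 = "gaussian_density m A" and ?f2 = "\<lambda>x. gaussian_density (n + R *v (x - m)) S"
  let ?g1 = "gaussian_density m' A'" and ?g2 = "\<lambda>x. gaussian_density (n' + R' *v (x - m')) S'"
  have F: "F x y = ?f1 x * ?f2 x y" and G: "G x y = ?g1 x * ?g2 x y" for x y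
    by (simp_all add: F_def G_def R_def S_def R'_def S'_def gaussian_density_block[OF pd]
        gaussian_density_block[OF pd'])
  have pos: "0 < ?f1 x" "0 < ?g1 x" "0 < ?f2 x y" "0 < ?g2 x y" for x y
    by (rule gaussian_density_pos, fact)+
  obtain K1 K2 K3 K4 where K: "0 \<le> K1" "0 \<le> K2"
    "\<And>x. \<bar>ln (?f1 x)\<bar> \<le> K1 * (1 + (norm x)\<^sup>2)" "\<And>x. \<bar>ln (?g1 x)\<bar> \<le> K2 * (1 + (norm x)\<^sup>2)"
    "\<And>z. \<bar>ln (gaussian_density (block_vector m n) (block_matrix A B C) z)\<bar> \<le> K3 * (1 + (norm z)\<^sup>2)"
    "\<And>z. \<bar>ln (gaussian_density (block_vector m' n') (block_matrix A' B' C') z)\<bar> \<le> K4 * (1 + (norm z)\<^sup>2)"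
    using ln_gaussian_density_bound[OF A, of m] ln_gaussian_density_bound[OF A', of m']
      ln_gaussian_density_bound[OF pd, of "block_vector m n"]
      ln_gaussian_density_bound[OF pd', of "block_vector m' n'"]
    by metis
  have b1: "\<bar>ln (?f1 x / ?g1 x)\<bar> \<le> (K1 + K2) * (1 + (norm (block_vector x y :: real^('p + 'q)))\<^sup>2)" for x y
  proof -
    have "\<bar>ln (?f1 x / ?g1 x)\<bar> \<le> \<bar>ln (?f1 x)\<bar> + \<bar>ln (?g1 x)\<bar>"
      using pos(1,2)[of x] by (simp add: ln_div abs_triangle_ineq4)
    also have "\<dots> \<le> (K1 + K2) * (1 + (norm x)\<^sup>2)" using K(3,4)[of x] by (simp add: distrib_right)
    also have "\<dots> \<le> (K1 + K2) * (1 + (norm (block_vector x y :: real^('p + 'q)))\<^sup>2)"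
      using K(1,2) by (intro mult_left_mono) (simp_all add: norm_block_vector)
    finally show ?thesis .
  qed
  \<comment> \<open>The conditional log ratio is the joint one minus the marginal one. Bounding
    these two avoids estimates for a density whose mean moves with \<open>x\<close>.\<close>
  have b2: "\<bar>ln (?f2 x y / ?g2 x y)\<bar> \<le>
      (K1 + K2 + K3 + K4) * (1 + (norm (block_vector x y :: real^('p + 'q)))\<^sup>2)" for x y
  proof -
    have "ln (F x y) - ln (G x y) = ln (?f1 x / ?g1 x) + ln (?f2 x y / ?g2 x y)"
      unfolding F G using pos(1,2)[of x] pos(3,4)[of x y] by (simp add: ln_div ln_mult less_imp_neq[symmetric])
    then have "\<bar>ln (?f2 x y / ?g2 x y)\<bar> \<le> \<bar>ln (F x y)\<bar> + \<bar>ln (G x y)\<bar> + \<bar>ln (?f1 x / ?g1 x)\<bar>" by linarith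
    also have "\<dots> \<le> (K1 + K2 + K3 + K4) * (1 + (norm (block_vector x y :: real^('p + 'q)))\<^sup>2)"
      using K(5,6)[of "block_vector x y"] b1[of x y] unfolding F_def G_def distrib_right by linarith
    finally show ?thesis .
  qed
  have "(\<integral>(x, y). F x y * ln (F x y / G x y) \<partial>(lborel \<Otimes>\<^sub>M lborel)) =
      (\<integral>x. ?f1 x * ln (?f1 x / ?g1 x) \<partial>lborel) \<longleftrightarrow> (AE (x, y) in lborel \<Otimes>\<^sub>M lborel. ?f2 x y = ?g2 x y)"
    unfolding F G
  proof (rule lborel_pair.KL_chain_rule_eq_iff)
    have "integrable (lborel \<Otimes>\<^sub>M lborel) (\<lambda>(x, y). F x y * ln (?f1 x / ?g1 x))"
      unfolding F_def by (rule gaussian_density_pair_integrable[OF pd _ b1]) simp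
    then show "integrable (lborel \<Otimes>\<^sub>M lborel) (\<lambda>(x, y). ?f1 x * ?f2 x y * ln (?f1 x / ?g1 x))"
      by (simp only: F)
    have "integrable (lborel \<Otimes>\<^sub>M lborel) (\<lambda>(x, y). F x y * ln (?f2 x y / ?g2 x y))"
      unfolding F_def by (rule gaussian_density_pair_integrable[OF pd _ b2]) simp
    then show "integrable (lborel \<Otimes>\<^sub>M lborel) (\<lambda>(x, y). ?f1 x * ?f2 x y * ln (?f2 x y / ?g2 x y))"
      by (simp only: F)
  qed (simp_all add: pos nn_integral_gaussian_density A S S')
  also have "\<dots> \<longleftrightarrow> (\<forall>x y. ?f2 x y = ?g2 x y)"
  proof
    assume "AE (x, y) in lborel \<Otimes>\<^sub>M lborel. ?f2 x y = ?g2 x y"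
    then have "AE z in lborel \<Otimes>\<^sub>M lborel. ?f2 (fst z) (snd z) = ?g2 (fst z) (snd z)"
      by (simp add: split_beta')
    note this[unfolded lborel_prod]
    from AE_lborel_continuous_eq[OF this continuous_on_gaussian_density_conditional
        continuous_on_gaussian_density_conditional, of "(_, _)"]
    show "\<forall>x y. ?f2 x y = ?g2 x y" by simp
  qed simp
  also have "\<dots> \<longleftrightarrow> (\<forall>x. n + R *v (x - m) = n' + R' *v (x - m') \<and> S = S')"
    using gaussian_density_inject[OF S S'] by metis
  also have "\<dots> \<longleftrightarrow> S = S' \<and> R = R' \<and> n - n' = R' *v (m - m')"
  proof
    assume eq: "\<forall>x. n + R *v (x - m) = n' + R' *v (x - m') \<and> S = S'"
    \<comment> \<open>At \<open>x = m\<close> the left regression term vanishes, which isolates the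
      condition on the means; at \<open>x = v + m\<close> the linear parts are compared.\<close>
    have n: "n = n' + R' *v (m - m')" using eq[rule_format, of m] by simp
    have "R *v v = R' *v v" for v
    proof -
      have "n + R *v v = n' + R' *v (v + m - m')" using eq[rule_format, of "v + m"] by simp
      also have "R' *v (v + m - m') = R' *v v + R' *v (m - m')"
        by (simp add: matrix_vector_right_distrib[symmetric] add_diff_eq)
      finally show ?thesis by (simp add: n)
    qed
    then show "S = S' \<and> R = R' \<and> n - n' = R' *v (m - m')" using eq n by (simp add: matrix_eq)
  next
    assume *: "S = S' \<and> R = R' \<and> n - n' = R' *v (m - m')"
    then have "n + R *v (x - m) = n' + (R' *v (m - m') + R' *v (x - m))" for x
      by (simp add: algebra_simps)
    then show "\<forall>x. n + R *v (x - m) = n' + R' *v (x - m') \<and> S = S'"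
      using * by (simp add: matrix_vector_right_distrib[symmetric])
  qed
  finally show ?thesis .
qed

section \<open>Whitney coordinates\<close>

text \<open>Separates the geometry from the rest: here the manifold enters only through
  \<open>bil\<close>, \<open>orth\<close> and the two bases.\<close>

locale whitney_coordinates =
  fixes \<A> :: "'m::t2_space chart set" and g :: "'m chart \<Rightarrow> real^3 \<Rightarrow> real^3^3"
    and K :: "'v::{finite,linorder} set set" and h :: "real^'v::{finite,linorder} \<Rightarrow> 'm"
    and e :: "'p::finite \<Rightarrow> real^('v set)" and f :: "'q::finite \<Rightarrow> real^('v set)"
  assumes bil: "bilinear (whitney_inner \<A> g K h 1)"
    and orth: "y \<in> gauge_space K \<Longrightarrow> x \<in> physical_space \<A> g K h \<Longrightarrow> whitney_inner \<A> g K h 1 y x = 0"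
    and e: "whitney_orthonormal_basis \<A> g K h e (physical_space \<A> g K h)"
    and f: "whitney_orthonormal_basis \<A> g K h f (gauge_space K)"
begin

abbreviation P where "P \<equiv> physical_projection \<A> g K h"

definition W where "W = whitney_inner \<A> g K h 1"
definition E where "E x = (\<Sum>i\<in>UNIV. x $ i *\<^sub>R e i)"
definition F where "F y = (\<Sum>j\<in>UNIV. y $ j *\<^sub>R f j)"

lemma span_e: "span (range e) = physical_space \<A> g K h" and span_f: "span (range f) = gauge_space K"
  using e f by (simp_all add: whitney_orthonormal_basis_def)

lemma e_mem: "e i \<in> physical_space \<A> g K h" and f_mem: "f j \<in> gauge_space K"
  using span_base[of "e i" "range e"] span_base[of "f j" "range f"] by (simp_all add: span_e span_f)

lemma W_ee: "W (e i) (e j) = (if i = j then 1 else 0)"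
  and W_ff: "W (f k) (f l) = (if k = l then 1 else 0)"
  and W_fe: "W (f k) (e j) = 0"
  using e f orth[OF f_mem e_mem] by (auto simp: whitney_orthonormal_basis_def W_def)

lemma linear_W: "linear (\<lambda>a. W a b)" "linear (W b)"
  using bil by (auto simp: bilinear_def W_def)

lemmas W_simps = linear_sum[OF linear_W(1)] linear_scale[OF linear_W(1)] linear_add[OF linear_W(1)]
  linear_diff[OF linear_W(1)] linear_sum[OF linear_W(2)] linear_scale[OF linear_W(2)]

lemma linear_E: "linear E" and linear_F: "linear F"
  by (auto simp: linear_iff E_def F_def scaleR_add_left sum.distrib scaleR_sum_right)

lemma E_mem: "E x \<in> physical_space \<A> g K h"
  unfolding E_def span_e[symmetric] by (intro span_sum span_scale span_base) auto

lemma F_mem: "F y \<in> gauge_space K"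
  unfolding F_def span_f[symmetric] by (intro span_sum span_scale span_base) auto

lemma W_E: "W (E x) (e j) = x $ j"
  by (simp add: E_def W_simps W_ee if_distrib cong: if_cong)

lemma W_F: "W (F y) (f j) = y $ j" "W (F y) (e i) = 0"
  by (simp_all add: F_def W_simps W_ff W_fe if_distrib cong: if_cong)

lemma linear_e_part: "linear (\<lambda>a. E (\<chi> i. W a (e i)))"
  by (rule linear_compose[OF _ linear_E, unfolded comp_def])
    (auto simp: linear_iff vec_eq_iff W_simps)

lemma physical_eq_E:
  assumes "x \<in> physical_space \<A> g K h"
  shows "x = E (\<chi> i. W x (e i))"
proof (rule linear_eq_on_span[OF linear_ident linear_e_part, of "range e"])
  fix z assume "z \<in> range e"
  then show "z = E (\<chi> i. W z (e i))" by (auto simp: E_def W_ee if_distrib[of "\<lambda>r. r *\<^sub>R _"] cong: if_cong)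
qed (use assms span_e in simp)

text \<open>Orthogonality of \<open>a - x\<close> to every \<open>e i\<close> fixes the coefficients
  of a candidate \<open>x\<close>, and by \<open>physical_eq_E\<close> these determine it; so the
  definite description has exactly one solution.\<close>

lemma projection_eq: "P a = E (\<chi> i. W a (e i))"
  unfolding physical_projection_def W_def[symmetric]
proof (rule the_equality)
  have "W (a - E (\<chi> i. W a (e i))) (E z) = 0" for z
    by (simp add: E_def[of z] W_simps W_E)
  then show "E (\<chi> i. W a (e i)) \<in> physical_space \<A> g K h \<and>
      (\<forall>y\<in>physical_space \<A> g K h. W (a - E (\<chi> i. W a (e i))) y = 0)"
    using E_mem physical_eq_E by metis
  fix x assume x: "x \<in> physical_space \<A> g K h \<and> (\<forall>y\<in>physical_space \<A> g K h. W (a - x) y = 0)"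
  then have "W a (e i) = W x (e i)" for i
    using e_mem[of i] by (simp add: W_simps)
  then show "x = E (\<chi> i. W a (e i))" using physical_eq_E x by simp
qed

lemma linear_projection: "linear P"
  unfolding projection_eq by (rule linear_e_part)

lemma projection_coordinates: "P (E x + F y) = E x"
  by (simp add: projection_eq W_simps W_E W_F)

text \<open>\<open>W_fe\<close> has the gauge cochain in the left slot. Pairing with
  \<open>e i\<close> on the right therefore ignores the gauge part, while the physical part is
  subtracted before pairing with \<open>f j\<close>.\<close>

lemma coordinates_left_inverse:
  "(\<chi> i. W (E x + F y) (e i)) = x" "(\<chi> j. W (E x + F y - P (E x + F y)) (f j)) = y"
  by (simp_all add: projection_coordinates W_simps W_E W_F vec_eq_iff)

definition "L = (\<lambda>(x, y). E x + F y)"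

lemma block_sum: "(\<Sum>i\<in>UNIV. block_vector x y $ i *\<^sub>R case_sum e f i) = L (x, y)"
  by (simp add: L_def E_def F_def block_vector_def UNIV_Plus_UNIV[symmetric] sum.Plus comp_def del: UNIV_Plus_UNIV)

lemma L_measurable: "L \<in> lborel \<Otimes>\<^sub>M lborel \<rightarrow>\<^sub>M restrict_space borel (cochains K 1)"
proof (rule measurable_restrict_space2)
  have "E x + F y \<in> cochains K 1" for x y
    using E_mem F_mem physical_space_subset_cochains gauge_space_subset_cochains
    by (intro subspace_add[OF subspace_cochains]) blast+
  then show "L \<in> space (lborel \<Otimes>\<^sub>M lborel) \<rightarrow> cochains K 1" by (auto simp: L_def)
  note [measurable] = borel_measurable_linear[OF linear_E] borel_measurable_linear[OF linear_F]
  show "L \<in> lborel \<Otimes>\<^sub>M lborel \<rightarrow>\<^sub>M borel" unfolding L_def by measurable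
qed

section \<open>Gaussian cochain measures, their physical marginals and their entropies\<close>

text \<open>With pairs in place of vectors over a sum type, the passage to the physical marginal
  becomes the projection \<open>fst\<close>.\<close>

lemma cochain_gaussian_eq:
  "cochain_gaussian K e f m \<Sigma> = distr (density (lborel \<Otimes>\<^sub>M lborel)
     (\<lambda>z. ennreal (gaussian_density m \<Sigma> (block_vector (fst z) (snd z)))))
     (restrict_space borel (cochains K 1)) L"
proof -
  let ?b = "\<lambda>(x :: real^'p, y :: real^'q). block_vector x y"
  let ?L = "\<lambda>z. \<Sum>i\<in>UNIV. z $ i *\<^sub>R case_sum e f i"
  have "?L \<in> borel \<rightarrow>\<^sub>M restrict_space borel (cochains K 1)"
  proof (rule measurable_restrict_space2)
    have "?L z \<in> cochains K 1" for z
      by (rule block_vector_exhaust[of z])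
        (use L_measurable[THEN measurable_space, of "(_, _)"] in \<open>simp add: block_sum space_pair_measure space_restrict_space\<close>)
    then show "?L \<in> space borel \<rightarrow> cochains K 1" by simp
    show "?L \<in> borel \<rightarrow>\<^sub>M borel"
      by (rule borel_measurable_linear) (auto simp: linear_iff scaleR_add_left sum.distrib scaleR_sum_right)
  qed
  moreover have "gaussian m \<Sigma> = distr (density (lborel \<Otimes>\<^sub>M lborel)
      (\<lambda>z. ennreal (gaussian_density m \<Sigma> (?b z)))) borel ?b"
    unfolding gaussian_eq_density
    by (subst lborel_distr_block_vector[symmetric], rule density_distr) auto
  ultimately have "cochain_gaussian K e f m \<Sigma> = distr (density (lborel \<Otimes>\<^sub>M lborel)
     (\<lambda>z. ennreal (gaussian_density m \<Sigma> (?b z)))) (restrict_space borel (cochains K 1)) (?L \<circ> ?b)"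
    unfolding cochain_gaussian_def by (simp add: distr_distr)
  also have "?L \<circ> ?b = L" by (auto simp: fun_eq_iff block_sum)
  finally show ?thesis by (simp add: split_beta')
qed

text \<open>Projecting after \<open>L\<close> is the same as \<open>E\<close> after
  \<open>fst\<close>, and integrating \<open>y\<close> out of the factored density leaves its
  marginal factor.\<close>

lemma physical_marginal_eq:
  assumes pd: "pos_def_matrix (block_matrix A B C)"
  shows "physical_marginal \<A> g K h (cochain_gaussian K e f (block_vector m n) (block_matrix A B C)) =
    distr (density lborel (\<lambda>x. ennreal (gaussian_density m A x)))
      (restrict_space borel (physical_space \<A> g K h)) E"
proof -
  note Apd = pos_def_block_upper[OF pd] and Spd = pos_def_schur_complement[OF pd]
  let ?f2 = "\<lambda>x. gaussian_density (n + transpose B ** matrix_inv A *v (x - m))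
    (C - transpose B ** matrix_inv A ** B)"
  let ?D = "density (lborel \<Otimes>\<^sub>M lborel) (\<lambda>(x, y). ennreal (gaussian_density m A x) * ennreal (?f2 x y))"
  let ?R = "restrict_space borel (physical_space \<A> g K h)"
  have D: "density (lborel \<Otimes>\<^sub>M lborel) (\<lambda>z. ennreal (gaussian_density (block_vector m n) (block_matrix A B C)
      (block_vector (fst z) (snd z)))) = ?D"
    using gaussian_density_pos[OF Apd, THEN less_imp_le]
    by (intro density_cong) (auto simp: gaussian_density_block[OF pd] ennreal_mult' split_beta')
  have E: "E \<in> lborel \<rightarrow>\<^sub>M ?R"
    using borel_measurable_linear[OF linear_E] E_mem by (intro measurable_restrict_space2) auto
  have P: "P \<in> restrict_space borel (cochains K 1) \<rightarrow>\<^sub>M ?R"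
    using borel_measurable_linear[OF linear_projection] E_mem
    by (intro measurable_restrict_space2 measurable_restrict_space1) (auto simp: projection_eq)
  have "physical_marginal \<A> g K h (cochain_gaussian K e f (block_vector m n) (block_matrix A B C)) =
      distr ?D ?R (P \<circ> L)"
    unfolding physical_marginal_def cochain_gaussian_eq D
    by (rule distr_distr[OF P]) (use L_measurable in simp)
  also have "P \<circ> L = E \<circ> fst" by (auto simp: L_def projection_coordinates fun_eq_iff)
  also have "distr ?D ?R (E \<circ> fst) = distr (distr ?D lborel fst) ?R E"
    by (rule distr_distr[OF E, symmetric]) simp
  also have "distr ?D lborel fst = density lborel (\<lambda>x. ennreal (gaussian_density m A x))"
    by (rule distr_fst_density[OF sigma_finite_lborel])
      (simp_all add: nn_integral_gaussian_density[OF Spd])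
  finally show ?thesis .
qed

lemma relative_entropy_cochain_gaussian:
  assumes pd: "pos_def_matrix \<Sigma>" and pd': "pos_def_matrix \<Sigma>'"
  shows "relative_entropy (cochain_gaussian K e f m \<Sigma>) (cochain_gaussian K e f m' \<Sigma>') =
    (\<integral>(x, y). gaussian_density m \<Sigma> (block_vector x y) *
      ln (gaussian_density m \<Sigma> (block_vector x y) / gaussian_density m' \<Sigma>' (block_vector x y))
      \<partial>(lborel \<Otimes>\<^sub>M lborel))"
proof -
  let ?T' = "\<lambda>a. ((\<chi> i. W a (e i)) :: real^'p, (\<chi> j. W (a - P a) (f j)) :: real^'q)"
  have T': "?T' \<in> restrict_space borel (cochains K 1) \<rightarrow>\<^sub>M lborel \<Otimes>\<^sub>M lborel"
  proof (rule measurable_restrict_space1, rule measurable_Pair)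
    show "(\<lambda>a. (\<chi> i. W a (e i)) :: real^'p) \<in> borel \<rightarrow>\<^sub>M lborel"
      by (simp, rule borel_measurable_linear) (auto simp: linear_iff vec_eq_iff W_simps)
    show "(\<lambda>a. (\<chi> j. W (a - P a) (f j)) :: real^'q) \<in> borel \<rightarrow>\<^sub>M lborel"
      by (simp, rule borel_measurable_linear)
        (auto simp: linear_iff vec_eq_iff W_simps linear_add[OF linear_projection]
          linear_scale[OF linear_projection] right_diff_distrib)
  qed
  have one: "(\<integral>\<^sup>+z. ennreal (gaussian_density m' \<Sigma>' (block_vector (fst z) (snd z))) \<partial>(lborel \<Otimes>\<^sub>M lborel)) = 1"
  proof -
    have "(\<integral>\<^sup>+z. ennreal (gaussian_density m' \<Sigma>' z) \<partial>distr (lborel \<Otimes>\<^sub>M lborel) borel (\<lambda>(x, y). block_vector x y)) = 1"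
      unfolding lborel_distr_block_vector by (rule nn_integral_gaussian_density[OF pd'])
    then show ?thesis by (subst (asm) nn_integral_distr) (auto simp: split_beta')
  qed
  have meas: "(\<lambda>z. gaussian_density m \<Sigma> (block_vector (fst z) (snd z))) \<in> borel_measurable (lborel \<Otimes>\<^sub>M lborel)" for m \<Sigma>
    using measurable_compose[OF block_vector_measurable gaussian_density_measurable] by (simp add: split_beta')
  have "?T' (L z) = z" for z
    using coordinates_left_inverse[of "fst z" "snd z"] by (simp add: L_def split_beta')
  then show ?thesis
    unfolding cochain_gaussian_eq
    by (subst relative_entropy_distr_density[OF lborel_pair.P.sigma_finite_measure_axioms L_measurable T' _ meas meas])
      (simp_all add: one gaussian_density_pos pd pd' split_beta')
qed

lemma relative_entropy_physical_gaussian: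
  assumes A: "pos_def_matrix A" and A': "pos_def_matrix A'"
  shows "relative_entropy
      (distr (density lborel (\<lambda>x. ennreal (gaussian_density m A x))) (restrict_space borel (physical_space \<A> g K h)) E)
      (distr (density lborel (\<lambda>x. ennreal (gaussian_density m' A' x))) (restrict_space borel (physical_space \<A> g K h)) E) =
    (\<integral>x. gaussian_density m A x * ln (gaussian_density m A x / gaussian_density m' A' x) \<partial>lborel)"
proof (rule relative_entropy_distr_density[OF sigma_finite_lborel])
  let ?R = "restrict_space borel (physical_space \<A> g K h)"
  show "E \<in> lborel \<rightarrow>\<^sub>M ?R"
    using borel_measurable_linear[OF linear_E] E_mem by (intro measurable_restrict_space2) auto
  show "(\<lambda>a. \<chi> i. W a (e i)) \<in> ?R \<rightarrow>\<^sub>M lborel"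
    by (rule measurable_restrict_space1, simp, rule borel_measurable_linear) (auto simp: linear_iff vec_eq_iff W_simps)
qed (simp_all add: W_E gaussian_density_pos A A' nn_integral_gaussian_density vec_eq_iff)

end

theorem corollary5:
  fixes M :: "'m::t2_space set"
    and \<A> :: "'m chart set"
    and g :: "'m chart \<Rightarrow> real^3 \<Rightarrow> real^3^3"
    and K :: "'v::{finite,linorder} set set"
    and h :: "real^'v::{finite,linorder} \<Rightarrow> 'm"
    and e :: "'p::finite \<Rightarrow> real^('v set)"
    and f :: "'q::finite \<Rightarrow> real^('v set)"
    and m\<mu>p m\<nu>p :: "real^'p" and m\<mu>g m\<nu>g :: "real^'q"
    and A\<mu> A\<nu> :: "real^'p^'p" and B\<mu> B\<nu> :: "real^'q^'p" and C\<mu> C\<nu> :: "real^'q^'q"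
    and R\<mu> R\<nu> :: "real^'p^'q" and S\<mu> S\<nu> :: "real^'q^'q"
    and \<mu> \<nu> \<mu>p \<nu>p :: "(real^('v set)) measure"
  assumes "closed_oriented_riemannian_3manifold M \<A> g"
    and "smooth_triangulation M \<A> K h"
    and "whitney_orthonormal_basis \<A> g K h e (physical_space \<A> g K h)"
    and "whitney_orthonormal_basis \<A> g K h f (gauge_space K)"
    and "pos_def_matrix (block_matrix A\<mu> B\<mu> C\<mu>)"
    and "pos_def_matrix (block_matrix A\<nu> B\<nu> C\<nu>)"
    and "\<mu> = cochain_gaussian K e f (block_vector m\<mu>p m\<mu>g) (block_matrix A\<mu> B\<mu> C\<mu>)"
    and "\<nu> = cochain_gaussian K e f (block_vector m\<nu>p m\<nu>g) (block_matrix A\<nu> B\<nu> C\<nu>)"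
    and "R\<mu> = transpose B\<mu> ** matrix_inv A\<mu>"
    and "R\<nu> = transpose B\<nu> ** matrix_inv A\<nu>"
    and "S\<mu> = C\<mu> - transpose B\<mu> ** matrix_inv A\<mu> ** B\<mu>"
    and "S\<nu> = C\<nu> - transpose B\<nu> ** matrix_inv A\<nu> ** B\<nu>"
    and "\<mu>p = physical_marginal \<A> g K h \<mu>"
    and "\<nu>p = physical_marginal \<A> g K h \<nu>"
  shows "relative_entropy \<mu> \<nu> = relative_entropy \<mu>p \<nu>p \<longleftrightarrow>
    S\<mu> = S\<nu> \<and> R\<mu> = R\<nu> \<and> m\<mu>g - m\<nu>g = R\<nu> *v (m\<mu>p - m\<nu>p)"
proof -
  interpret whitney_coordinates \<A> g K h e f
    by (rule whitney_coordinates.intro[OF bilinear_whitney_inner[OF assms(1,2)]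
          whitney_inner_gauge_physical[OF assms(1,2)] assms(3,4)])
  note pd = assms(5,6)
  have "relative_entropy \<mu>p \<nu>p = (\<integral>x. gaussian_density m\<mu>p A\<mu> x *
      ln (gaussian_density m\<mu>p A\<mu> x / gaussian_density m\<nu>p A\<nu> x) \<partial>lborel)"
    unfolding assms(7,8,13,14) physical_marginal_eq[OF pd(1)] physical_marginal_eq[OF pd(2)]
    by (rule relative_entropy_physical_gaussian[OF pos_def_block_upper[OF pd(1)] pos_def_block_upper[OF pd(2)]])
  then show ?thesis
    unfolding assms(7,8) relative_entropy_cochain_gaussian[OF pd] assms(9-12)
    using gaussian_entropy_eq_marginal_entropy_iff[OF pd, of m\<mu>p m\<mu>g m\<nu>p m\<nu>g] by simp
qed

end
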